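(* Let $n\ge2$. For $q$ ranging over prime powers and for any choice, for each $q$, of a factorization $\Lambda_1\Lambda_2\cdots\Lambda_{n-1}=q^2+1$ into positive integers, there exists an asymptotically optimal family of ideal $(\Lambda_1\times\Lambda_2\times\cdots\times\Lambda_{n-1}\times(q+1),\,q+1,\,0,\,2)$ $n$-D OOCs. That is, for every prime power $q$ there is a code $C_q$ with these parameters such that $$\lim_{q\to\infty}\frac{|C_q|}{J_q}=1,$$ where $J_q$ is the Johnson bound for ideal codes with these parameters.
   Context: An $n$-dimensional optical orthogonal code ($n$-D OOC) with parameters $(\Lambda_1\times\cdots\times\Lambda_{n-1}\times T,w,\lambda_a,\lambda_c)$ is a set $C$ of binary ($0/1$) arrays $A=(a_{i_1,\dots,i_n})$, indexed by $0\le i_s\le\Lambda_s-1$ for $1\le s\le n-1$ and $0\le i_n\le T-1$, called codewords, each having exactly $w$ entries equal to $1$, such that (the last subscript being read modulo $T$): (i) for every $A\in C$ and every integer $1\le t\le T-1$, $\sum_{i_1,\dots,i_n}a_{i_1,\dots,i_n}a_{i_1,\dots,i_n+t}\le\lambda_a$; (ii) for all distinct $A,B\in C$ and every integer $0\le t\le T-1$, $\sum_{i_1,\dots,i_n}a_{i_1,\dots,i_n}b_{i_1,\dots,i_n+t}\le\lambda_c$. The sums run over all index tuples. The code is ideal if $\lambda_a=0$. The Johnson bound for ideal $(\Lambda_1\times\cdots\times\Lambda_{n-1}\times T,w,0,\lambda_c)$ codes, with $N=\Lambda_1\cdots\Lambda_{n-1}T$, is $\left\lfloor\frac{N}{Tw}\left\lfloor\frac{N-T}{w-1}\left\lfloor\cdots\left\lfloor\frac{N-\lambda_cT}{w-\lambda_c}\right\rfloor\cdots\right\rfloor\right\rfloor\right\rfloor$.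 For $\Lambda_1\cdots\Lambda_{n-1}=q^2+1$, $T=w=q+1$, $\lambda_c=2$, $N=(q^2+1)(q+1)$ it is (for $q\ge2$) $$J_q=\left\lfloor\frac{N}{Tw}\left\lfloor\frac{N-T}{w-1}\left\lfloor\frac{N-2T}{w-2}\right\rfloor\right\rfloor\right\rfloor .$$ *)

theory Defs
  imports
    Complex_Main
    "HOL-Library.FuncSet"
    "HOL-Number_Theory.Prime_Powers"
begin

text \<open>
  An index tuple \<open>(i\<^sub>1, \<dots>, i\<^sub>n)\<close> is an extensional function on \<open>{1..n}\<close>. Only the values of
  \<open>\<Lambda>\<close> on \<open>{1..n - 1}\<close> matter; the range of the last subscript is \<open>T\<close>.
\<close>

definition index_tuples :: "nat \<Rightarrow> (nat \<Rightarrow> nat) \<Rightarrow> nat \<Rightarrow> (nat \<Rightarrow> nat) set" where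
  "index_tuples n \<Lambda> T = (\<Pi>\<^sub>E s\<in>{1..n}. {..<(\<Lambda>(n := T)) s})"

text \<open>
  Extensionality makes two arrays equal iff their entries agree, so that \<^const>\<open>card\<close> counts
  codewords correctly.
\<close>

definition binary_arrays :: "nat \<Rightarrow> (nat \<Rightarrow> nat) \<Rightarrow> nat \<Rightarrow> ((nat \<Rightarrow> nat) \<Rightarrow> nat) set" where
  "binary_arrays n \<Lambda> T = index_tuples n \<Lambda> T \<rightarrow>\<^sub>E {0, 1}"

definition shift_last :: "nat \<Rightarrow> nat \<Rightarrow> nat \<Rightarrow> (nat \<Rightarrow> nat) \<Rightarrow> (nat \<Rightarrow> nat)" where
  "shift_last n T t i = i(n := (i n + t) mod T)"

definition correlation ::
  "nat \<Rightarrow> (nat \<Rightarrow> nat) \<Rightarrow> nat \<Rightarrow> ((nat \<Rightarrow> nat) \<Rightarrow> nat) \<Rightarrow> ((nat \<Rightarrow> nat) \<Rightarrow> nat) \<Rightarrow> nat \<Rightarrow> nat" where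
  "correlation n \<Lambda> T A B t = (\<Sum>i\<in>index_tuples n \<Lambda> T. A i * B (shift_last n T t i))"

definition is_OOC ::
  "nat \<Rightarrow> (nat \<Rightarrow> nat) \<Rightarrow> nat \<Rightarrow> nat \<Rightarrow> nat \<Rightarrow> nat \<Rightarrow> ((nat \<Rightarrow> nat) \<Rightarrow> nat) set \<Rightarrow> bool" where
  "is_OOC n \<Lambda> T w la lc C \<longleftrightarrow>
     C \<subseteq> binary_arrays n \<Lambda> T \<and>
     (\<forall>A\<in>C. card {i \<in> index_tuples n \<Lambda> T. A i = 1} = w) \<and>
     (\<forall>A\<in>C. \<forall>t. 1 \<le> t \<and> t < T \<longrightarrow> correlation n \<Lambda> T A A t \<le> la) \<and>
     (\<forall>A\<in>C. \<forall>B\<in>C. A \<noteq> B \<longrightarrow> (\<forall>t<T. correlation n \<Lambda> T A B t \<le> lc))"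

definition is_ideal_OOC ::
  "nat \<Rightarrow> (nat \<Rightarrow> nat) \<Rightarrow> nat \<Rightarrow> nat \<Rightarrow> nat \<Rightarrow> ((nat \<Rightarrow> nat) \<Rightarrow> nat) set \<Rightarrow> bool" where
  "is_ideal_OOC n \<Lambda> T w lc C \<longleftrightarrow> is_OOC n \<Lambda> T w 0 lc C"

text \<open>
  The fold produces the inner floors, with factors \<open>(N - kT) / (w - k)\<close> for \<open>k = 1, \<dots>, lc\<close> from
  the outside in. The bound is meaningful for \<open>lc < w\<close>.
\<close>

definition ideal_johnson_bound ::
  "nat \<Rightarrow> (nat \<Rightarrow> nat) \<Rightarrow> nat \<Rightarrow> nat \<Rightarrow> nat \<Rightarrow> int" where
  "ideal_johnson_bound n \<Lambda> T w lc =
     (let N = real ((\<Prod>s\<in>{1..n - 1}. \<Lambda> s) * T) in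
      \<lfloor>N / (real T * real w) *
        of_int (foldr (\<lambda>k x. \<lfloor>(N - real k * real T) / (real w - real k) * of_int x\<rfloor>)
                  [1..<Suc lc] 1)\<rfloor>)"

lemma ideal_johnson_bound_2:
  assumes "N = real ((\<Prod>s\<in>{1..n - 1}. \<Lambda> s) * T)"
  shows "ideal_johnson_bound n \<Lambda> T w 2 =
    \<lfloor>N / (real T * real w) *
      of_int \<lfloor>(N - real T) / (real w - 1) *
        of_int \<lfloor>(N - 2 * real T) / (real w - 2)\<rfloor>\<rfloor>\<rfloor>"
  unfolding ideal_johnson_bound_def assms by (simp add: upt_rec Let_def)

end

theory Submission
  imports
    Defs
    "HOL-Computational_Algebra.Polynomial_Factorial"
    "HOL-Real_Asymp.Real_Asymp"
begin

text \<open>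
  Let \<open>K\<close> be the field with \<open>q\<^sup>2\<close> elements, \<open>N x = x ^ (q + 1)\<close> its norm onto the field with \<open>q\<close>
  elements, and \<open>U\<close> the group of elements of norm one, which is cyclic of order \<open>q + 1\<close>. Index the
  rows of an array by the elements of \<open>K\<close>, leaving one of the \<open>q\<^sup>2 + 1\<close> rows empty, and the \<open>q + 1\<close>
  columns by \<open>U\<close>, so that a cyclic shift becomes a multiplication by an element of \<open>U\<close>.

  A codeword is a Moebius map of \<open>U\<close> carried over to a circle. The circle \<open>N (y - a) = N r\<close> consists
  of the \<open>q + 1\<close> points \<open>a + r * u\<close> with \<open>u\<close> in \<open>U\<close>, and the map
  \<open>u \<mapsto> (u + b) / (b ^ q * u + 1)\<close> sends \<open>U\<close> to \<open>U\<close> unless \<open>N b = 1\<close>. The codeword of \<open>(a, r, b)\<close>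
  has in the row of \<open>a + r * u\<close> its only one in the column \<open>(u + b) / (b ^ q * u + 1)\<close>. As no row
  contains two ones, the code is ideal. For the cross-correlation there are two cases.

  \<^item> Two different circles have at most two common points
    (\<open>circles_eq_if_three_common_points\<close>), and a common entry of two codewords lies in the row of a
    common point.
  \<^item> On the same circle, two Moebius maps with different \<open>b\<close> agree at no more than two points, and
    this remains true after one of them is multiplied by an element of \<open>U\<close>
    (\<open>moebius_eq_if_agree_at_three\<close>).

  Both bounds hold because a quadratic equation over a field has at most two roots. There are
  \<open>q\<^sup>2 * (q - 1)\<close> circles and \<open>(q - 2) * (q + 1)\<close> nonzero \<open>b\<close> with \<open>N b \<noteq> 1\<close>. Hence the code has
  \<open>q\<^sup>2 * (q - 1) * (q - 2) * (q + 1)\<close> words, while the Johnson bound is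
  \<open>q * (q + 1)\<^sup>2 * (q\<^sup>2 + 1)\<close>. Both are asymptotic to \<open>q\<^sup>5\<close>.

  The field itself is obtained as the residue ring of the integer polynomials modulo a prime ideal
  that contains the characteristic and the cyclotomic polynomial of order \<open>q\<^sup>2 - 1\<close>
  (\<open>exists_quadratic_field\<close>). The class of \<open>X\<close> is then a primitive element.
\<close>

section \<open>Congruence modulo a prime ideal\<close>

text \<open>
  The finite fields are residue rings of one fixed ring, and an equation in a finite field is written
  as a congruence between elements of that ring. As a type can not depend on the characteristic,
  this is what makes the algebra of the type class of commutative rings available for all of them.
\<close>

locale prime_ideal =
  fixes I :: "'a::comm_ring_1 set"
  assumes zero_mem: "0 \<in> I"
    and add_mem: "x \<in> I \<Longrightarrow> y \<in> I \<Longrightarrow> x + y \<in> I"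
    and mult_mem: "x \<in> I \<Longrightarrow> r * x \<in> I"
    and one_not_mem: "1 \<notin> I"
    and prime: "x * y \<in> I \<Longrightarrow> x \<in> I \<or> y \<in> I"
begin

definition eqv :: "'a \<Rightarrow> 'a \<Rightarrow> bool" (infix "\<approx>" 50) where
  "x \<approx> y \<longleftrightarrow> x - y \<in> I"

lemma uminus_mem: "x \<in> I \<Longrightarrow> - x \<in> I"
  using mult_mem[of x "-1"] by simp

lemma diff_mem: "x \<in> I \<Longrightarrow> y \<in> I \<Longrightarrow> x - y \<in> I"
  using add_mem[OF _ uminus_mem, of x y] by simp

lemma mult_mem': "x \<in> I \<Longrightarrow> x * r \<in> I"
  using mult_mem[of x r] by (simp add: mult.commute)

lemma sum_mem: "(\<And>a. a \<in> A \<Longrightarrow> f a \<in> I) \<Longrightarrow> sum f A \<in> I"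
  by (induction A rule: infinite_finite_induct) (auto intro: zero_mem add_mem)

lemma power_mem_iff: "n > 0 \<Longrightarrow> x ^ n \<in> I \<longleftrightarrow> x \<in> I"
proof
  show "x \<in> I" if "x ^ n \<in> I"
    using that by (induction n) (use one_not_mem prime in auto)
  show "x ^ n \<in> I" if "x \<in> I" "n > 0"
    using that by (cases n) (auto intro: mult_mem')
qed

lemma eqv_refl [simp, intro]: "x \<approx> x"
  by (simp add: eqv_def zero_mem)

lemma eqv_sym: "x \<approx> y \<Longrightarrow> y \<approx> x"
  unfolding eqv_def using uminus_mem by fastforce

lemma eqv_trans [trans]: "x \<approx> y \<Longrightarrow> y \<approx> z \<Longrightarrow> x \<approx> z"
  unfolding eqv_def using add_mem[of "x - y" "y - z"] by simp

lemma eqv_add: "x \<approx> x' \<Longrightarrow> y \<approx> y' \<Longrightarrow> x + y \<approx> x' + y'"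
  unfolding eqv_def using add_mem[of "x - x'" "y - y'"] by (simp add: algebra_simps)

lemma eqv_diff: "x \<approx> x' \<Longrightarrow> y \<approx> y' \<Longrightarrow> x - y \<approx> x' - y'"
  unfolding eqv_def using diff_mem[of "x - x'" "y - y'"] by (simp add: algebra_simps)

lemma eqv_mult:
  assumes "x \<approx> x'" "y \<approx> y'"
  shows "x * y \<approx> x' * y'"
proof -
  have "x * y - x' * y' = y * (x - x') + x' * (y - y')"
    by (simp add: algebra_simps)
  then show ?thesis
    using assms unfolding eqv_def by (metis add_mem mult_mem)
qed

lemma eqv_power: "x \<approx> y \<Longrightarrow> x ^ n \<approx> y ^ n"
  by (induction n) (auto intro: eqv_mult)

lemma eqv_mult_left: "x \<approx> y \<Longrightarrow> c * x \<approx> c * y"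
  by (simp add: eqv_mult)

lemma eqv_mem_iff: "x \<approx> y \<Longrightarrow> x \<in> I \<longleftrightarrow> y \<in> I"
  unfolding eqv_def using add_mem[of "x - y" y] diff_mem[of x "x - y"] by auto

lemma eqv_zero_iff: "x \<approx> 0 \<longleftrightarrow> x \<in> I"
  by (simp add: eqv_def)

lemma eqv_cancel:
  assumes "c * x \<approx> c * y" "c \<notin> I"
  shows "x \<approx> y"
  using assms prime[of c "x - y"] by (simp add: eqv_def right_diff_distrib)

lemma eqv_cancel_power: "x ^ k * y \<approx> x ^ k * z \<Longrightarrow> x \<notin> I \<Longrightarrow> y \<approx> z"
  by (cases "k = 0") (auto intro: eqv_cancel simp: power_mem_iff)

text \<open>
  A polynomial with more roots than its degree vanishes identically. The roots have to be distinct
  modulo the ideal: after one root is split off, the factor \<open>x - r\<close> is cancelled at the others.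
\<close>

lemma coeff_mem_if_many_roots:
  assumes "degree P < card R" "\<And>x. x \<in> R \<Longrightarrow> poly P x \<in> I"
    and "\<And>x y. x \<in> R \<Longrightarrow> y \<in> R \<Longrightarrow> x \<approx> y \<Longrightarrow> x = y"
  shows "coeff P i \<in> I"
  using assms
proof (induction "degree P" arbitrary: P R i)
  case 0
  then obtain c where P: "P = [:c:]"
    by (metis degree_eq_zeroE)
  from 0 obtain x where "x \<in> R"
    by (metis card.empty equals0I less_irrefl)
  with 0 P have "c \<in> I"
    by fastforce
  then show ?case
    by (auto simp: P coeff_pCons zero_mem split: nat.split)
next
  case (Suc n)
  from Suc.prems obtain r where r: "r \<in> R"
    by (metis card.empty equals0I not_less0)
  have fin: "finite R"
    using Suc.prems(1) by (metis card.infinite not_less0)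
  let ?Q = "synthetic_div P r"
  have P: "P = [:- r, 1:] * ?Q + [:poly P r:]"
    using synthetic_div_correct'[of r P] by simp
  have Q: "coeff ?Q j \<in> I" for j
  proof (rule Suc.hyps(1)[of ?Q "R - {r}"])
    show "degree ?Q < card (R - {r})"
      using Suc.hyps(2) Suc.prems(1) r fin by (simp add: degree_synthetic_div)
    fix x assume x: "x \<in> R - {r}"
    have "poly P x = (x - r) * poly ?Q x + poly P r"
      by (subst P) (simp add: algebra_simps)
    then have "(x - r) * poly ?Q x \<in> I"
      using Suc.prems(2)[of x] Suc.prems(2)[OF r] x
      by (metis Diff_iff add_diff_cancel_right' diff_mem)
    then show "poly ?Q x \<in> I"
      using prime Suc.prems(3)[of x r] x r by (auto simp: eqv_def)
  qed (use Suc degree_synthetic_div[of P r] in auto)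
  have "coeff P i = coeff ([:- r, 1:] * ?Q) i + coeff [:poly P r:] i"
    by (subst P) simp
  moreover have "coeff ([:- r, 1:] * ?Q) i \<in> I"
    using Q by (auto simp: coeff_pCons split: nat.split intro!: diff_mem uminus_mem mult_mem)
  moreover have "coeff [:poly P r:] i \<in> I"
    using Suc.prems(2)[OF r] by (auto simp: coeff_pCons zero_mem split: nat.split)
  ultimately show ?case
    by (simp add: add_mem)
qed

text \<open>
  The instance from which both correlation bounds follow: a quadratic congruence with three distinct
  solutions is trivial.
\<close>

lemma quadratic_coeffs_mem:
  assumes "card R \<ge> 3" "\<And>x. x \<in> R \<Longrightarrow> c0 + c1 * x + c2 * x ^ 2 \<in> I"
    and "\<And>x y. x \<in> R \<Longrightarrow> y \<in> R \<Longrightarrow> x \<approx> y \<Longrightarrow> x = y"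
  shows "c0 \<in> I" "c1 \<in> I" "c2 \<in> I"
proof -
  have c: "coeff [:c0, c1, c2:] i \<in> I" for i
  proof (rule coeff_mem_if_many_roots[of _ R])
    show "degree [:c0, c1, c2:] < card R"
      using assms(1) degree_pCons_le[of c0 "[:c1, c2:]"] degree_pCons_le[of c1 "[:c2:]"] by simp
    show "poly [:c0, c1, c2:] x \<in> I" if "x \<in> R" for x
      using assms(2)[OF that] by (simp add: algebra_simps power2_eq_square)
  qed (use assms(3) in auto)
  show "c0 \<in> I" "c1 \<in> I" "c2 \<in> I"
    using c[of 0] c[of 1] c[of 2] by (simp_all add: numeral_2_eq_2)
qed

text \<open>
  The exponents \<open>n\<close> with \<open>x ^ n \<approx> 1\<close> are the multiples of the least positive one, which therefore
  divides \<open>m\<close>.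
\<close>

lemma power_eqv_iff_mod_eq:
  assumes m: "m > 0" "x ^ m \<approx> 1" and order: "\<And>d. 0 < d \<Longrightarrow> d < m \<Longrightarrow> d dvd m \<Longrightarrow> \<not> x ^ d \<approx> 1"
  shows "x ^ i \<approx> x ^ j \<longleftrightarrow> i mod m = j mod m"
proof -
  have "x \<notin> I"
    using eqv_mem_iff[OF m(2)] power_mem_iff[OF m(1)] one_not_mem by blast
  define d where "d = (LEAST d. 0 < d \<and> x ^ d \<approx> 1)"
  have d: "0 < d" "x ^ d \<approx> 1"
    using LeastI[of "\<lambda>d. 0 < d \<and> x ^ d \<approx> 1" m] m by (auto simp: d_def)
  have multiple: "x ^ (a + d * c) \<approx> x ^ a" for a c
    using eqv_mult[OF eqv_refl[of "x ^ a"] eqv_power[OF d(2), of c]]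
    by (simp add: power_add power_mult)
  have d_dvd: "d dvd n" if n: "x ^ n \<approx> 1" for n
  proof (rule ccontr)
    assume "\<not> d dvd n"
    then have "0 < n mod d" "n mod d < d"
      using d(1) by (auto simp: dvd_eq_mod_eq_0)
    moreover have "x ^ (n mod d) \<approx> 1"
      using multiple[of "n mod d" "n div d"] n eqv_sym eqv_trans by (metis mod_mult_div_eq)
    ultimately show False
      unfolding d_def using not_less_Least by blast
  qed
  have "d = m"
    using d d_dvd[OF m(2)] m(1) order[of d] by (meson dvd_imp_le nat_less_le)
  have iff: "x ^ i \<approx> x ^ j \<longleftrightarrow> i mod m = j mod m" if "i \<le> j" for i j
  proof
    assume "x ^ i \<approx> x ^ j"
    then have "x ^ i * x ^ (j - i) \<approx> x ^ i * 1"
      using that eqv_sym by (simp flip: power_add)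
    then have "m dvd j - i"
      using eqv_cancel_power[OF _ \<open>x \<notin> I\<close>] d_dvd \<open>d = m\<close> by blast
    then show "i mod m = j mod m"
      using that by (metis mod_eq_dvd_iff_nat)
  next
    assume "i mod m = j mod m"
    then have "m dvd j - i"
      using that by (metis mod_eq_dvd_iff_nat)
    then obtain c where "j - i = m * c"
      by auto
    then have "j = i + m * c"
      using that by simp
    then show "x ^ i \<approx> x ^ j"
      using eqv_sym[OF multiple[of i c]] by (simp only: \<open>d = m\<close>)
  qed
  show ?thesis
  proof (cases "i \<le> j")
    case False
    then have "x ^ j \<approx> x ^ i \<longleftrightarrow> j mod m = i mod m"
      by (intro iff) simp
    then show ?thesis
      by (metis eqv_sym)
  qed (rule iff)
qed

lemma frobenius_add:
  assumes p: "prime p" "of_nat p \<in> I"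
  shows "(x + y) ^ (p ^ k) \<approx> x ^ (p ^ k) + y ^ (p ^ k)"
proof (induction k)
  case (Suc k)
  have binom: "(a + b) ^ p \<approx> a ^ p + b ^ p" for a b
  proof -
    let ?t = "\<lambda>i. of_nat (p choose i) * a ^ i * b ^ (p - i)"
    have p0: "p > 0"
      using p(1) by (simp add: prime_gt_0_nat)
    have "{..p} = insert 0 (insert p {0<..<p})"
      using p0 by auto
    then have "(a + b) ^ p = ?t 0 + (?t p + sum ?t {0<..<p})"
      using p0 by (simp add: binomial_ring)
    then have "(a + b) ^ p - (a ^ p + b ^ p) = sum ?t {0<..<p}"
      by simp
    moreover have "?t i \<in> I" if "i \<in> {0<..<p}" for i
    proof -
      have "p dvd p choose i"
        using that p(1) by (intro dvd_choose_prime) auto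
      then obtain c where "p choose i = p * c"
        by auto
      then have "?t i = of_nat p * (of_nat c * a ^ i * b ^ (p - i))"
        by (simp add: mult.assoc)
      then show ?thesis
        using mult_mem'[OF p(2)] by metis
    qed
    ultimately show ?thesis
      unfolding eqv_def using sum_mem[of "{0<..<p}" ?t] by simp
  qed
  have "((x + y) ^ (p ^ k)) ^ p \<approx> (x ^ (p ^ k)) ^ p + (y ^ (p ^ k)) ^ p"
    using eqv_trans[OF eqv_power[OF Suc.IH] binom] .
  then show ?case
    by (simp add: mult.commute flip: power_mult)
qed simp

lemma frobenius_of_int:
  assumes p: "prime p" "of_nat p \<in> I"
  shows "of_int c ^ (p ^ k) \<approx> of_int c"
proof -
  have pos: "p ^ k > 0"
    using p(1) by (simp add: prime_gt_0_nat)
  have nat: "of_nat n ^ (p ^ k) \<approx> of_nat n" for n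
  proof (induction n)
    case 0
    then show ?case
      using pos by (simp add: zero_power)
  next
    case (Suc n)
    then show ?case
      using eqv_trans[OF frobenius_add[OF p, of 1 "of_nat n" k] eqv_add[OF eqv_refl]] by simp
  qed
  show ?thesis
  proof (cases c)
    case (nonneg n)
    then show ?thesis
      using nat by simp
  next
    case (neg n)
    let ?n = "of_nat (Suc n) :: 'a" and ?c = "of_int c :: 'a"
    have c: "?c = - ?n"
      using neg by simp
    have "(?n + ?c) ^ (p ^ k) = 0"
      using pos by (simp add: c zero_power)
    then have "0 \<approx> ?n ^ (p ^ k) + ?c ^ (p ^ k)"
      using frobenius_add[OF p, of ?n ?c k] by simp
    then have "0 - ?n ^ (p ^ k) \<approx> ?n ^ (p ^ k) + ?c ^ (p ^ k) - ?n ^ (p ^ k)"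
      by (rule eqv_diff) (rule eqv_refl)
    then have "?c ^ (p ^ k) \<approx> 0 - ?n ^ (p ^ k)"
      unfolding add_diff_cancel_left' by (rule eqv_sym)
    also have "\<dots> \<approx> 0 - ?n"
      by (intro eqv_diff nat eqv_refl)
    finally show ?thesis
      by (simp add: c)
  qed
qed

text \<open>
  The \<open>m\<close> powers of a primitive root of unity already exhaust the roots of \<open>X\<^sup>m - 1\<close>.
\<close>

lemma root_of_unity_eqv_power:
  assumes m: "m > 0" and x: "x ^ m \<approx> 1" and y: "y ^ m \<approx> 1"
    and order: "\<And>i j. x ^ i \<approx> x ^ j \<longleftrightarrow> i mod m = j mod m"
  shows "\<exists>i. y \<approx> x ^ i"
proof (rule ccontr)
  assume contra: "\<nexists>i. y \<approx> x ^ i"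
  let ?X = "(\<lambda>i. x ^ i) ` {..<m}"
  let ?P = "monom 1 m - 1 :: 'a poly"
  have distinct: "i = j" if "x ^ i \<approx> x ^ j" "i < m" "j < m" for i j
    using that order[of i j] by simp
  then have "inj_on (\<lambda>i. x ^ i) {..<m}"
    by (intro inj_onI) (metis eqv_refl lessThan_iff)
  then have "card ?X = m"
    by (simp add: card_image)
  moreover have "y \<notin> ?X"
    using contra by blast
  ultimately have card: "card (insert y ?X) = Suc m"
    by simp
  have "coeff ?P m \<in> I"
  proof (rule coeff_mem_if_many_roots[of _ "insert y ?X"])
    have "degree ?P \<le> m"
      by (intro degree_diff_le) (auto simp: degree_monom_le)
    then show "degree ?P < card (insert y ?X)"
      unfolding card by simp
    fix r assume "r \<in> insert y ?X"
    moreover have "(x ^ i) ^ m \<approx> 1" for i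
      using eqv_power[OF x, of i] by (simp add: mult.commute flip: power_mult)
    ultimately have "r ^ m \<approx> 1"
      using y by auto
    then show "poly ?P r \<in> I"
      by (simp add: eqv_def poly_monom)
    fix s assume "s \<in> insert y ?X" "r \<approx> s"
    then show "r = s"
      using \<open>r \<in> insert y ?X\<close> contra distinct eqv_sym by blast
  qed
  then show False
    using m one_not_mem by simp
qed

end

text \<open>
  By Zorn's lemma a proper ideal lies in a maximal one, and maximal ideals are prime: if \<open>x\<close> is
  outside, then \<open>i + r * x = 1\<close> for some \<open>i\<close> inside, and multiplication by \<open>y\<close> shows that \<open>y\<close> is
  inside whenever \<open>x * y\<close> is.
\<close>

lemma proper_ideal_subset_prime_ideal:
  fixes J :: "'a::comm_ring_1 set"
  assumes "0 \<in> J" "\<And>x y. x \<in> J \<Longrightarrow> y \<in> J \<Longrightarrow> x + y \<in> J"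
    and "\<And>r x. x \<in> J \<Longrightarrow> r * x \<in> J" "1 \<notin> J"
  shows "\<exists>I. J \<subseteq> I \<and> prime_ideal I"
proof -
  define proper where "proper K \<longleftrightarrow> J \<subseteq> K \<and> (\<forall>x\<in>K. \<forall>y\<in>K. x + y \<in> K) \<and>
    (\<forall>r. \<forall>x\<in>K. r * x \<in> K) \<and> 1 \<notin> K" for K :: "'a set"
  have "\<exists>M\<in>Collect proper. \<forall>X\<in>Collect proper. M \<subseteq> X \<longrightarrow> X = M"
  proof (rule subset_Zorn_nonempty)
    have "proper J"
      using assms by (simp add: proper_def)
    then show "Collect proper \<noteq> {}"
      by blast
    fix C assume ne: "C \<noteq> {}" and chain: "subset.chain (Collect proper) C"
    have C: "proper K" if "K \<in> C" for K
      using chain that by (auto simp: subset.chain_def)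
    have "x + y \<in> \<Union>C" if xy: "x \<in> \<Union>C" "y \<in> \<Union>C" for x y
    proof -
      obtain K L where "K \<in> C" "x \<in> K" "L \<in> C" "y \<in> L"
        using xy by blast
      moreover from this have "K \<subseteq> L \<or> L \<subseteq> K"
        using chain by (auto simp: subset_chain_def)
      ultimately obtain M where "M \<in> C" "x \<in> M" "y \<in> M"
        by blast
      then show ?thesis
        using C[of M] by (auto simp: proper_def)
    qed
    moreover have "J \<subseteq> \<Union>C" "1 \<notin> \<Union>C"
      using ne C unfolding proper_def by blast+
    moreover have "r * x \<in> \<Union>C" if "x \<in> \<Union>C" for r x
      using that C unfolding proper_def by blast
    ultimately show "\<Union>C \<in> Collect proper"
      by (simp add: proper_def)
  qed
  then obtain I where I: "proper I" and max: "\<And>X. proper X \<Longrightarrow> I \<subseteq> X \<Longrightarrow> X = I"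
    by auto
  have "y \<in> I" if "x * y \<in> I" "x \<notin> I" for x y
  proof -
    let ?X = "{i + r * x |i r. i \<in> I}"
    have 0: "0 \<in> I"
      using I assms(1) by (auto simp: proper_def)
    have "i \<in> ?X" if "i \<in> I" for i
    proof -
      have "i = i + 0 * x"
        by simp
      then show ?thesis
        using that by blast
    qed
    then have "I \<subseteq> ?X"
      by blast
    moreover have "x = 0 + 1 * x"
      by simp
    then have "x \<in> ?X"
      using 0 by blast
    ultimately have "\<not> proper ?X"
      using max[of ?X] \<open>x \<notin> I\<close> by blast
    moreover have "u + v \<in> ?X" if uv: "u \<in> ?X" "v \<in> ?X" for u v
    proof -
      obtain i r j s where "i \<in> I" "u = i + r * x" "j \<in> I" "v = j + s * x"
        using uv by blast
      then have "u + v = (i + j) + (r + s) * x" "i + j \<in> I"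
        using I by (auto simp: proper_def distrib_right)
      then show ?thesis
        by blast
    qed
    moreover have "s * u \<in> ?X" if u: "u \<in> ?X" for s u
    proof -
      obtain i r where "i \<in> I" "u = i + r * x"
        using u by blast
      then have "s * u = s * i + (s * r) * x" "s * i \<in> I"
        using I by (auto simp: proper_def distrib_left mult.assoc)
      then show ?thesis
        by blast
    qed
    moreover have "J \<subseteq> ?X"
      using \<open>I \<subseteq> ?X\<close> I by (auto simp: proper_def)
    ultimately have "1 \<in> ?X"
      unfolding proper_def by blast
    then obtain i r where "i \<in> I" "1 = i + r * x"
      by auto
    then have "y = y * i + r * (x * y)"
      by (metis distrib_left mult.assoc mult.commute mult.right_neutral)
    moreover have "y * i \<in> I" "r * (x * y) \<in> I"
      using I \<open>i \<in> I\<close> that by (auto simp: proper_def)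
    ultimately show ?thesis
      using I unfolding proper_def by metis
  qed
  then have "prime_ideal I"
    using I assms(1) unfolding proper_def by unfold_locales blast+
  then show ?thesis
    using I by (auto simp: proper_def)
qed

section \<open>Finite fields as residue rings of integer polynomials\<close>

definition eval_at :: "complex \<Rightarrow> int poly \<Rightarrow> complex" where
  "eval_at z P = poly (map_poly of_int P) z"

lemma eval_at_pCons: "eval_at z (pCons c P) = of_int c + z * eval_at z P"
  by (simp add: eval_at_def map_poly_pCons)

lemma eval_at_0 [simp]: "eval_at z 0 = 0"
  by (simp add: eval_at_def)

lemma eval_at_1 [simp]: "eval_at z 1 = 1"
  by (simp add: one_pCons eval_at_pCons)

lemma eval_at_add: "eval_at z (P + Q) = eval_at z P + eval_at z Q"
  by (induction P Q rule: poly_induct2) (simp_all add: eval_at_pCons algebra_simps)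

lemma eval_at_smult: "eval_at z (smult c P) = of_int c * eval_at z P"
  by (induction P) (simp_all add: eval_at_pCons algebra_simps)

lemma eval_at_mult: "eval_at z (P * Q) = eval_at z P * eval_at z Q"
  by (induction P) (simp_all add: eval_at_add eval_at_smult eval_at_pCons algebra_simps)

lemma eval_at_diff: "eval_at z (P - Q) = eval_at z P - eval_at z Q"
  using eval_at_add[of z "P - Q" Q] by simp

lemma eval_at_monom: "eval_at z (monom 1 n) = z ^ n"
  by (induction n) (simp_all add: monom_0 monom_Suc eval_at_pCons)

lemma exists_prime_factor_with_root:
  assumes "P \<noteq> 0" "eval_at z P = 0"
  shows "\<exists>f. prime f \<and> f dvd P \<and> eval_at z f = 0"
  using assms
proof (induction P rule: prime_divisors_induct)
  case (unit P)
  then obtain Q where "1 = P * Q"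
    by auto
  then show ?case
    using unit.prems eval_at_mult[of z P Q] by simp
next
  case (factor f P)
  then show ?case
    by (cases "eval_at z f = 0") (auto simp: eval_at_mult dvd_mult)
qed simp

text \<open>
  Modulo \<open>p\<close>, a nonzero multiple of \<open>f\<close> has at least the degree of \<open>f\<close>, because the leading
  coefficient of \<open>f\<close> is a unit, and so it can not be the constant \<open>1\<close>. The induction makes \<open>b\<close>
  smaller: in a representation of \<open>1\<close>, the top coefficient of \<open>b\<close> is divisible by \<open>p\<close>, and the top
  term can be absorbed by \<open>a\<close>.
\<close>

lemma int_and_monic_generate_proper_ideal:
  fixes f a b :: "int poly" and p :: int
  assumes "is_unit (lead_coeff f)" "degree f > 0" "\<not> is_unit p"
  shows "smult p a + f * b \<noteq> 1"
proof (induction "if b = 0 then 0 else Suc (degree b)" arbitrary: a b rule: less_induct)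
  case less
  show ?case
  proof
    assume eq: "smult p a + f * b = 1"
    have "b \<noteq> 0"
    proof
      assume "b = 0"
      then have "p * coeff a 0 = coeff (smult p a + f * b) 0"
        by simp
      then have "p * coeff a 0 = 1"
        by (simp only: eq coeff_1) simp
      then show False
        using assms(3) by (metis dvd_triv_left)
    qed
    let ?n = "degree b"
    have "coeff (smult p a + f * b) (degree f + ?n) = 0"
      using eq assms(2) by simp
    then have "p * coeff a (degree f + ?n) + lead_coeff f * lead_coeff b = 0"
      by (simp add: coeff_mult_degree_sum)
    then have "p dvd lead_coeff f * lead_coeff b"
      using dvd_add_right_iff[of p "p * coeff a (degree f + ?n)" "lead_coeff f * lead_coeff b"] by simp
    then have "p dvd lead_coeff b"
      by (simp only: dvd_mult_unit_iff'[OF assms(1)])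
    then obtain c where c: "lead_coeff b = p * c"
      by auto
    let ?b = "b - monom (p * c) ?n"
    have "smult p (a + f * monom c ?n) + f * ?b = 1"
      using eq by (simp add: algebra_simps smult_add_right smult_monom flip: mult_smult_right)
    moreover have "?b = 0 \<or> degree ?b < degree b"
      using eq_zero_or_degree_less[of ?b ?n]
      by (simp add: c degree_diff_le degree_monom_le)
    ultimately show False
      using less[of ?b] \<open>b \<noteq> 0\<close> by auto
  qed
qed

text \<open>
  Let \<open>f\<close> be the irreducible factor of \<open>X\<^sup>m - 1\<close> that vanishes at a primitive \<open>m\<close>-th root of unity,
  that is, the \<open>m\<close>-th cyclotomic polynomial, and take a prime ideal above \<open>p\<close> and \<open>f\<close>. If the order
  of \<open>X\<close> were a proper divisor \<open>d\<close> of \<open>m\<close>, then \<open>f\<close> divides \<open>(X\<^sup>m - 1) / (X\<^sup>d - 1)\<close>, which is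
  congruent to \<open>m / d\<close>, and \<open>m / d\<close> is coprime to \<open>p\<close>.
\<close>

lemma exists_prime_ideal_with_order:
  fixes p m :: nat
  assumes p: "prime p" and m: "m > 0" and coprime: "\<not> p dvd m"
  shows "\<exists>I :: int poly set. prime_ideal I \<and> of_nat p \<in> I \<and>
    (\<forall>i j. monom 1 i - monom 1 j \<in> I \<longleftrightarrow> i mod m = j mod m)"
proof -
  let ?x = "monom 1 (Suc 0) :: int poly"
  have x_power: "?x ^ n = monom 1 n" for n
    by (simp add: monom_power)
  define z where "z = cis (2 * pi / m)"
  have z_power: "z ^ n = cis (2 * pi * n / m)" for n
    by (simp add: z_def DeMoivre mult_ac)
  have z_m: "z ^ m = 1"
    using m by (simp add: z_power)
  have z_d: "z ^ d \<noteq> 1" if "0 < d" "d < m" for d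
  proof
    assume "z ^ d = 1"
    then have "cis (2 * pi * real d / real m) = cis (2 * pi * real 0 / real m)"
      by (simp add: z_power)
    then have "d = 0"
      using bij_betw_imp_inj_on[OF bij_betw_roots_unity[OF m]] m that(2)
      unfolding inj_on_def by (metis lessThan_iff)
    then show False
      using that by simp
  qed
  let ?P = "monom 1 m - 1 :: int poly"
  have deg_P: "degree ?P = m"
    using m by (intro antisym degree_diff_le le_degree) (auto simp: degree_monom_le)
  then have "?P \<noteq> 0"
    using m by (metis degree_0 less_irrefl)
  moreover have "eval_at z ?P = 0"
    by (simp add: eval_at_diff eval_at_monom z_m)
  ultimately obtain f where f: "prime f" "f dvd ?P" "eval_at z f = 0"
    using exists_prime_factor_with_root by blast
  obtain h where h: "?P = f * h"
    using f(2) by auto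
  have "lead_coeff ?P = 1"
    using m by (simp add: deg_P)
  then have "1 = lead_coeff f * lead_coeff h"
    by (metis h lead_coeff_mult)
  then have unit: "is_unit (lead_coeff f)"
    by (rule dvdI)
  have deg_f: "degree f > 0"
  proof (rule ccontr)
    assume "\<not> degree f > 0"
    then obtain c where "f = [:c:]"
      by (meson degree_eq_zeroE neq0_conv)
    with f(3) unit show False
      by (auto simp: eval_at_pCons)
  qed
  define J where "J = {smult (int p) a + f * b |a b. True}"
  have "\<exists>I. J \<subseteq> I \<and> prime_ideal I"
  proof (rule proper_ideal_subset_prime_ideal)
    show "0 \<in> J"
      unfolding J_def by (auto intro!: exI[of _ 0])
    show "u + v \<in> J" if "u \<in> J" "v \<in> J" for u v
    proof -
      from \<open>u \<in> J\<close> obtain a b where u: "u = smult (int p) a + f * b"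
        unfolding J_def by blast
      from \<open>v \<in> J\<close> obtain a' b' where v: "v = smult (int p) a' + f * b'"
        unfolding J_def by blast
      have "u + v = smult (int p) (a + a') + f * (b + b')"
        by (simp add: u v algebra_simps smult_add_right)
      then show ?thesis
        unfolding J_def by blast
    qed
    show "r * u \<in> J" if "u \<in> J" for r u
    proof -
      from \<open>u \<in> J\<close> obtain a b where u: "u = smult (int p) a + f * b"
        unfolding J_def by blast
      have "r * u = smult (int p) (r * a) + f * (r * b)"
        by (simp add: u algebra_simps)
      then show ?thesis
        unfolding J_def by blast
    qed
    have "\<not> is_unit (int p)"
      using p by (metis not_prime_unit prime_int_nat_transfer prime_nat_int_transfer)
    then have "smult (int p) a + f * b \<noteq> 1" for a b
      using int_and_monic_generate_proper_ideal[OF unit deg_f] by blast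
    then show "1 \<notin> J"
      unfolding J_def by (smt (verit) mem_Collect_eq)
  qed
  then obtain I where "J \<subseteq> I" and prime_I: "prime_ideal I"
    by blast
  interpret prime_ideal I
    by (rule prime_I)
  have "of_nat p = smult (int p) 1 + f * 0"
    by (simp add: of_nat_poly)
  then have "of_nat p \<in> J"
    unfolding J_def by blast
  then have p_mem: "of_nat p \<in> I"
    using \<open>J \<subseteq> I\<close> by blast
  have "f * b = smult (int p) 0 + f * b" for b
    by simp
  then have "f * b \<in> J" for b
    unfolding J_def by blast
  then have f_mem: "u \<in> I" if "f dvd u" for u
    using that \<open>J \<subseteq> I\<close> by (auto elim!: dvdE)
  have "?x ^ d - 1 \<notin> I" if d: "0 < d" "d < m" "d dvd m" for d
  proof
    assume d_mem: "?x ^ d - 1 \<in> I"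
    obtain k where k: "m = d * k"
      using d(3) by auto
    let ?S = "\<Sum>i<k. (?x ^ d) ^ i"
    have "?P = (?x ^ d - 1) * ?S"
      using power_diff_1_eq[of "?x ^ d" k] by (simp add: k x_power monom_power mult.commute)
    moreover have "\<not> f dvd ?x ^ d - 1"
    proof
      assume "f dvd ?x ^ d - 1"
      then obtain u where "?x ^ d - 1 = f * u"
        by auto
      then have "eval_at z (?x ^ d - 1) = eval_at z f * eval_at z u"
        by (simp add: eval_at_mult)
      then have "z ^ d = 1"
        by (simp add: x_power eval_at_diff eval_at_monom f(3))
      then show False
        using z_d d by blast
    qed
    ultimately have "f dvd ?S"
      using f(1,2) by (metis prime_dvd_mult_iff)
    then have S: "?S \<in> I"
      by (rule f_mem)
    have "(?x ^ d) ^ i - 1 \<in> I" for i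
      unfolding power_diff_1_eq[of "?x ^ d" i] by (rule mult_mem'[OF d_mem])
    then have "(\<Sum>i<k. (?x ^ d) ^ i - 1) \<in> I"
      by (intro sum_mem)
    then have "?S - of_nat k \<in> I"
      by (simp add: sum_subtractf)
    then have k_mem: "of_nat k \<in> I"
      using diff_mem[OF S] by fastforce
    have "\<not> p dvd k"
      using coprime k by auto
    then have "coprime (int p) (int k)"
      using p by (simp add: prime_imp_coprime)
    then obtain a b where "a * int p + b * int k = 1"
      by (metis bezout_int coprime_imp_gcd_eq_1)
    then have "of_int (a * int p + b * int k) = (1 :: int poly)"
      by simp
    then have "of_int a * of_nat p + of_int b * of_nat k = (1 :: int poly)"
      by (simp only: of_int_add of_int_mult of_int_of_nat_eq)
    then show False
      using one_not_mem add_mem mult_mem p_mem k_mem by metis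
  qed
  then have "\<not> eqv (?x ^ d) 1" if "0 < d" "d < m" "d dvd m" for d
    using that unfolding eqv_def by blast
  moreover have "eqv (?x ^ m) 1"
    unfolding eqv_def x_power by (rule f_mem[OF f(2)])
  ultimately have "eqv (?x ^ i) (?x ^ j) \<longleftrightarrow> i mod m = j mod m" for i j
    using m by (intro power_eqv_iff_mod_eq)
  then have "monom 1 i - monom 1 j \<in> I \<longleftrightarrow> i mod m = j mod m" for i j
    unfolding eqv_def x_power by blast
  then show ?thesis
    using prime_I p_mem by blast
qed

text \<open>
  The residue field is a field with \<open>q\<^sup>2\<close> elements and primitive element \<open>g\<close>. Raising to the power
  \<open>q\<close> is its conjugation over the subfield with \<open>q\<close> elements, and \<open>x ^ (q + 1)\<close> is the norm.
\<close>

locale quadratic_field = prime_ideal I for I :: "'a::comm_ring_1 set" +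
  fixes q :: nat and g :: 'a
  assumes q_ge_2: "q \<ge> 2"
    and frobenius: "(x + y) ^ q \<approx> x ^ q + y ^ q"
    and generates: "x \<notin> I \<Longrightarrow> \<exists>i. x \<approx> g ^ i"
    and gen_power_eqv_iff: "g ^ i \<approx> g ^ j \<longleftrightarrow> i mod ((q - 1) * (q + 1)) = j mod ((q - 1) * (q + 1))"

text \<open>
  The number \<open>q\<^sup>2 - 1\<close> is prime to the characteristic, so some residue ring of the integer
  polynomials has an \<open>X\<close> of exactly this order. By the Frobenius endomorphism every residue is a
  root of \<open>Y ^ (q\<^sup>2) - Y\<close>, and the roots other than zero are powers of \<open>X\<close>. No residue is left over,
  so that the residue ring has \<open>q\<^sup>2\<close> elements and not a larger power of the characteristic.
\<close>

theorem exists_quadratic_field: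
  fixes q :: nat
  assumes "primepow q"
  shows "\<exists>(I :: int poly set) g. quadratic_field I q g"
proof -
  obtain p k where p: "prime p" and k: "k > 0" and q: "q = p ^ k"
    using assms by (auto simp: primepow_def)
  have q2: "q \<ge> 2"
    using primepow_gt_Suc_0[OF assms] by simp
  define m where "m = (q - 1) * (q + 1)"
  have m: "m > 0" "Suc m = q * q"
    using q2 by (cases q; simp add: m_def)+
  have "p dvd Suc m"
    using k by (simp add: m(2) q)
  then have "\<not> p dvd m"
    using p by (metis Suc_eq_plus1 dvd_add_right_iff not_prime_unit)
  then obtain I :: "int poly set" where I: "prime_ideal I" "of_nat p \<in> I"
    and order: "\<And>i j. monom 1 i - monom 1 j \<in> I \<longleftrightarrow> i mod m = j mod m"
    using exists_prime_ideal_with_order[OF p m(1)] by blast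
  interpret prime_ideal I
    by (rule I(1))
  let ?x = "monom 1 (Suc 0) :: int poly"
  have x_power: "?x ^ n = monom 1 n" for n
    by (simp add: monom_power)
  have x_eqv: "eqv (?x ^ i) (?x ^ j) \<longleftrightarrow> i mod m = j mod m" for i j
    unfolding eqv_def x_power by (rule order)
  have x_m: "eqv (?x ^ m) 1"
    using x_eqv[of m 0] by simp
  have qq: "q * q = p ^ (k + k)"
    by (simp add: q power_add)
  have "eqv (?x ^ Suc m) (?x ^ 1)"
    unfolding x_eqv by (metis Suc_eq_plus1_left mod_add_self2)
  then have x_qq: "eqv (?x ^ (q * q)) ?x"
    by (simp add: m(2))
  \<comment> \<open>Both sides are additive and multiplicative in \<open>P\<close>, so integers and \<open>X\<close> are enough.\<close>
  have fixed: "eqv (P ^ (q * q)) P" for P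
  proof (induction P)
    case 0
    then show ?case
      using q2 by (simp add: zero_power)
  next
    case (pCons c P)
    have eq: "pCons c P = of_int c + ?x * P"
      by (simp add: of_int_poly monom_Suc monom_0)
    have "eqv ((of_int c + ?x * P) ^ (q * q)) (of_int c ^ (q * q) + (?x * P) ^ (q * q))"
      unfolding qq by (rule frobenius_add[OF p I(2)])
    also have "eqv (of_int c ^ (q * q) + (?x * P) ^ (q * q)) (of_int c + ?x * P)"
      unfolding power_mult_distrib[of ?x]
      by (intro eqv_add eqv_mult x_qq pCons.IH) (unfold qq, rule frobenius_of_int[OF p I(2)])
    finally show ?case
      unfolding eq .
  qed
  have "quadratic_field I q ?x"
  proof unfold_locales
    show "q \<ge> 2"
      by (rule q2)
    show "eqv ((x + y) ^ q) (x ^ q + y ^ q)" for x y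
      unfolding q by (rule frobenius_add[OF p I(2)])
    show "\<exists>i. eqv x (?x ^ i)" if "x \<notin> I" for x
    proof (rule root_of_unity_eqv_power[OF m(1) x_m _ x_eqv])
      have "eqv (x * x ^ m) (x * 1)"
        using fixed[of x] by (simp flip: m(2))
      then show "eqv (x ^ m) 1"
        using that by (rule eqv_cancel)
    qed
    show "eqv (?x ^ i) (?x ^ j) \<longleftrightarrow> i mod ((q - 1) * (q + 1)) = j mod ((q - 1) * (q + 1))" for i j
      using x_eqv by (simp add: m_def)
  qed
  then show ?thesis
    by blast
qed

section \<open>Circles and Moebius maps over the field with q squared elements\<close>

context quadratic_field
begin

lemma pred_q_pos: "q - 1 > 0"
  using q_ge_2 by simp

lemma gen_not_mem: "g \<notin> I"
proof
  assume "g \<in> I"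
  moreover have "g ^ ((q - 1) * (q + 1)) \<approx> g ^ 0"
    unfolding gen_power_eqv_iff by (simp only: mod_self mod_0)
  ultimately have "1 \<in> I"
    using eqv_mem_iff[of "g ^ ((q - 1) * (q + 1))" 1] power_mem_iff[of "(q - 1) * (q + 1)" g] pred_q_pos
    by simp
  then show False
    using one_not_mem by simp
qed

lemma gen_power_not_mem: "g ^ i \<notin> I"
proof (cases "i = 0")
  case True
  then show ?thesis
    by (simp add: one_not_mem)
next
  case False
  then show ?thesis
    using power_mem_iff[of i g] gen_not_mem by simp
qed

lemma conjugate_conjugate: "(x ^ q) ^ q \<approx> x"
proof (cases "x \<in> I")
  case True
  then have "(x ^ q) ^ q \<in> I"
    using q_ge_2 by (simp add: power_mem_iff)
  then show ?thesis
    unfolding eqv_def using True by (rule diff_mem)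
next
  case False
  then obtain i where i: "x \<approx> g ^ i"
    using generates by blast
  have "q * q = 1 + (q - 1) * (q + 1)"
    using q_ge_2 by (cases q) auto
  then have "i * (q * q) = i + i * ((q - 1) * (q + 1))"
    by (metis distrib_left mult.right_neutral)
  then have "i * (q * q) mod ((q - 1) * (q + 1)) = i mod ((q - 1) * (q + 1))"
    by (simp only: mod_mult_self1)
  then have "g ^ (i * (q * q)) \<approx> g ^ i"
    by (simp only: gen_power_eqv_iff)
  moreover have "(x ^ q) ^ q \<approx> g ^ (i * (q * q))"
    using eqv_power[OF i, of "q * q"] by (simp add: power_mult mult.assoc)
  ultimately show ?thesis
    using i eqv_sym eqv_trans by blast
qed

lemma conjugate_diff: "(x - y) ^ q \<approx> x ^ q - y ^ q"
proof -
  have "(x - y + y) ^ q - y ^ q \<approx> (x - y) ^ q + y ^ q - y ^ q"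
    by (intro eqv_diff frobenius eqv_refl)
  then have "x ^ q - y ^ q \<approx> (x - y) ^ q"
    by simp
  then show ?thesis
    by (rule eqv_sym)
qed

text \<open>The elements of norm one form a cyclic group of order \<open>q + 1\<close>, in which \<open>unit\<close> is the exponential.\<close>

definition unit :: "nat \<Rightarrow> 'a" where
  "unit j = g ^ ((q - 1) * j)"

lemma unit_add: "unit (i + j) = unit i * unit j"
  by (simp only: unit_def distrib_left power_add)

lemma unit_not_mem: "unit j \<notin> I"
  by (simp add: unit_def gen_power_not_mem)

lemma unit_norm: "unit j ^ (q + 1) \<approx> 1"
proof -
  have "g ^ ((q - 1) * j * (q + 1)) \<approx> g ^ 0"
    unfolding gen_power_eqv_iff
    by (metis mod_0 mod_mult_self2_is_0 mult.assoc mult.commute)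
  then show ?thesis
    by (simp only: unit_def power_mult power_0)
qed

lemma unit_eqv_iff: "unit i \<approx> unit j \<longleftrightarrow> i mod (q + 1) = j mod (q + 1)"
proof -
  have "q - 1 \<noteq> 0"
    using q_ge_2 by simp
  then show ?thesis
    unfolding unit_def gen_power_eqv_iff mult_mod_right[symmetric] by (simp only: mult_cancel1) simp
qed

lemma unit_inject: "unit i \<approx> unit j \<Longrightarrow> i \<le> q \<Longrightarrow> j \<le> q \<Longrightarrow> i = j"
  unfolding unit_eqv_iff by (metis Suc_eq_plus1 le_imp_less_Suc mod_less)

text \<open>Nonzero elements have the polar coordinates \<open>k < q - 1\<close> and \<open>j \<le> q\<close>.\<close>

lemma norm_polar: "(g ^ k * unit j) ^ (q + 1) \<approx> g ^ (k * (q + 1))"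
  using eqv_mult[OF eqv_refl unit_norm, of "(g ^ k) ^ (q + 1)" j]
  by (simp only: power_mult_distrib power_mult mult_1_right)

lemma gen_norm_inject:
  assumes "g ^ (k * (q + 1)) \<approx> g ^ (l * (q + 1))" "k < q - 1" "l < q - 1"
  shows "k = l"
proof -
  have "k * (q + 1) mod ((q - 1) * (q + 1)) = l * (q + 1) mod ((q - 1) * (q + 1))"
    using assms(1) unfolding gen_power_eqv_iff .
  then have "k mod (q - 1) * (q + 1) = l mod (q - 1) * (q + 1)"
    by (simp only: mult_mod_left)
  then have "k * (q + 1) = l * (q + 1)"
    using assms(2,3) by (simp only: mod_less)
  then show ?thesis
    by (simp only: mult_cancel2) simp
qed

lemma polar_inject:
  assumes "g ^ k * unit i \<approx> g ^ l * unit j" "k < q - 1" "l < q - 1" "i \<le> q" "j \<le> q"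
  shows "k = l \<and> i = j"
proof -
  have "(g ^ k * unit i) ^ (q + 1) \<approx> (g ^ l * unit j) ^ (q + 1)"
    using assms(1) by (rule eqv_power)
  then have "g ^ (k * (q + 1)) \<approx> g ^ (l * (q + 1))"
    using norm_polar eqv_sym eqv_trans by meson
  then have "k = l"
    using assms gen_norm_inject by blast
  moreover from this have "unit i \<approx> unit j"
    using assms(1) eqv_cancel gen_power_not_mem by blast
  ultimately show ?thesis
    using assms unit_inject by blast
qed

text \<open>
  As \<open>g ^ (q + 1)\<close> has order \<open>q - 1\<close>, elements of equal norm have exponents that agree modulo
  \<open>q - 1\<close>, and \<open>unit\<close> takes the powers of \<open>g ^ (q - 1)\<close>.
\<close>

lemma unit_multiple_if_same_norm:
  assumes "x \<notin> I" "y \<notin> I" "x ^ (q + 1) \<approx> y ^ (q + 1)"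
  shows "\<exists>e\<le>q. unit e * y \<approx> x"
proof -
  obtain i j where i: "x \<approx> g ^ i" and j: "y \<approx> g ^ j"
    using generates assms(1,2) by metis
  \<comment> \<open>Adding a multiple of the order of \<open>g\<close> to \<open>i\<close> makes the difference of exponents nonnegative.\<close>
  define i' where "i' = i + j * ((q - 1) * (q + 1))"
  have "g ^ i \<approx> g ^ i'"
    unfolding gen_power_eqv_iff i'_def by (simp only: mod_mult_self1)
  then have i': "x \<approx> g ^ i'"
    using i eqv_trans by blast
  have "1 \<le> (q - 1) * (q + 1)"
    using pred_q_pos by (simp add: Suc_le_eq)
  then have "j * 1 \<le> j * ((q - 1) * (q + 1))"
    by (rule mult_le_mono2)
  then have le: "j \<le> i'"
    by (simp only: i'_def mult_1_right trans_le_add2)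
  have "(g ^ i') ^ (q + 1) \<approx> (g ^ j) ^ (q + 1)"
    using eqv_power[OF i', of "q + 1"] eqv_power[OF j, of "q + 1"] assms(3) eqv_sym eqv_trans by meson
  then have "(i' * (q + 1)) mod ((q - 1) * (q + 1)) = (j * (q + 1)) mod ((q - 1) * (q + 1))"
    unfolding gen_power_eqv_iff[symmetric] by (simp only: power_mult)
  then have "i' mod (q - 1) * (q + 1) = j mod (q - 1) * (q + 1)"
    by (simp only: mult_mod_left)
  then have "i' mod (q - 1) = j mod (q - 1)"
    by (simp only: mult_cancel2) simp
  then have "q - 1 dvd i' - j"
    using mod_eq_dvd_iff_nat[OF le] by blast
  then obtain l where "i' - j = (q - 1) * l"
    by auto
  then have l: "i' = j + (q - 1) * l"
    using le by simp
  have "unit (l mod (q + 1)) \<approx> unit l"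
    unfolding unit_eqv_iff by simp
  then have "unit (l mod (q + 1)) * y \<approx> unit l * g ^ j"
    using j by (rule eqv_mult)
  also have "unit l * g ^ j = g ^ i'"
    by (simp add: l unit_def power_add mult.commute)
  finally have "unit (l mod (q + 1)) * y \<approx> x"
    using i' eqv_sym eqv_trans by blast
  moreover have "l mod (q + 1) \<le> q"
    using mod_less_divisor[of "q + 1" l] by linarith
  ultimately show ?thesis
    by blast
qed

text \<open>
  For a unit \<open>u\<close>, the inverse of \<open>u\<close> is its conjugate, so that \<open>u + b\<close> and \<open>b ^ q * u + 1\<close> are
  conjugate up to the factor \<open>u\<close>. Hence they have the same norm, and the Moebius map
  \<open>u \<mapsto> (u + b) / (b ^ q * u + 1)\<close> preserves the group of units. A common zero would be at \<open>u = - b\<close>,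
  and then \<open>b\<close> has norm one.
\<close>

lemma moebius_maps_units_to_units:
  assumes b: "\<not> b ^ (q + 1) \<approx> 1"
  shows "\<exists>e\<le>q. unit e * (b ^ q * unit j + 1) \<approx> unit j + b"
proof -
  define u where "u = unit j"
  define N D where "N = u + b" and "D = b ^ q * u + 1"
  have u: "u * u ^ q \<approx> 1" "u \<notin> I"
    using unit_norm[of j] unit_not_mem by (simp_all add: u_def)
  have "u * N ^ q \<approx> u * (u ^ q + b ^ q)"
    unfolding N_def by (intro eqv_mult_left frobenius)
  also have "u * (u ^ q + b ^ q) = u * u ^ q + b ^ q * u"
    by (simp add: algebra_simps)
  also have "\<dots> \<approx> 1 + b ^ q * u"
    by (intro eqv_add u(1) eqv_refl)
  finally have N: "u * N ^ q \<approx> D"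
    by (simp add: D_def add.commute)
  have "u * D ^ q \<approx> u * ((b ^ q) ^ q * u ^ q + 1)"
    unfolding D_def using eqv_mult_left[OF frobenius[of "b ^ q * u" 1]]
    by (simp add: power_mult_distrib)
  also have "u * ((b ^ q) ^ q * u ^ q + 1) = (b ^ q) ^ q * (u * u ^ q) + u"
    by (simp add: algebra_simps)
  also have "\<dots> \<approx> b * 1 + u"
    by (intro eqv_add eqv_mult conjugate_conjugate u(1) eqv_refl)
  finally have D: "u * D ^ q \<approx> N"
    by (simp add: N_def add.commute)
  have q: "q > 0"
    using q_ge_2 by simp
  have mem_iff: "D \<in> I \<longleftrightarrow> N \<in> I"
    using eqv_mem_iff[OF N] prime[of u "N ^ q"] mult_mem[of "N ^ q" u] u(2) power_mem_iff[OF q] by blast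
  have "\<not> (N \<in> I \<and> D \<in> I)"
  proof
    assume "N \<in> I \<and> D \<in> I"
    then have "b ^ q * N - D \<in> I"
      by (intro diff_mem mult_mem) auto
    also have "b ^ q * N - D = b ^ (q + 1) - 1"
      by (simp add: N_def D_def algebra_simps)
    finally show False
      using b by (simp add: eqv_def)
  qed
  then have not_mem: "N \<notin> I" "D \<notin> I"
    using mem_iff by auto
  have "(u * N ^ q) * N \<approx> D * (u * D ^ q)"
    using N eqv_sym[OF D] by (rule eqv_mult)
  then have "u * N ^ (q + 1) \<approx> u * D ^ (q + 1)"
    by (simp add: mult_ac)
  then have "N ^ (q + 1) \<approx> D ^ (q + 1)"
    using u(2) by (rule eqv_cancel)
  then show ?thesis
    using unit_multiple_if_same_norm not_mem unfolding N_def D_def u_def by blast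
qed

text \<open>
  The equations \<open>(y - a) ^ (q + 1) = c\<close> and \<open>(y - a') ^ (q + 1) = c'\<close> of two circles are linear in
  the conjugate of \<open>y\<close>. Eliminating it leaves a quadratic equation for \<open>y\<close> with leading coefficient
  \<open>a ^ q - a' ^ q\<close>. If that vanishes, the centres agree, and then so do the right hand sides.
\<close>

lemma circles_eq_if_three_common_points:
  assumes R: "card R \<ge> 3" "\<And>x y. x \<in> R \<Longrightarrow> y \<in> R \<Longrightarrow> x \<approx> y \<Longrightarrow> x = y"
    and c: "\<And>y. y \<in> R \<Longrightarrow> (y - a) ^ (q + 1) \<approx> c" "\<And>y. y \<in> R \<Longrightarrow> (y - a') ^ (q + 1) \<approx> c'"
  shows "a \<approx> a' \<and> c \<approx> c'"
proof -
  define A A' where "A = a ^ q" and "A' = a' ^ q"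
  define \<kappa> where "\<kappa> = c - c' - A * a + A' * a'"
  have expand: "(y ^ q - z ^ q) * (y - z) - r \<in> I" if "(y - z) ^ (q + 1) \<approx> r" for y z r
  proof -
    have "(y ^ q - z ^ q) * (y - z) \<approx> (y - z) ^ q * (y - z)"
      by (intro eqv_mult eqv_sym[OF conjugate_diff] eqv_refl)
    also have "(y - z) ^ q * (y - z) = (y - z) ^ (q + 1)"
      by simp
    finally show ?thesis
      using eqv_trans that unfolding eqv_def by blast
  qed
  have quadratic: "(- (\<kappa> - A * (a' - a)) * a - (a' - a) * c) +
      (\<kappa> - A * (a' - a) + (A' - A) * a) * y + (A - A') * y ^ 2 \<in> I" (is "?Q y \<in> I")
    if "y \<in> R" for y
  proof -
    define E E' where "E = (y ^ q - A) * (y - a) - c" and "E' = (y ^ q - A') * (y - a') - c'"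
    have "E \<in> I" "E' \<in> I"
      using expand c that by (simp_all add: E_def E'_def A_def A'_def)
    \<comment> \<open>The conjugate of \<open>y\<close> has coefficient \<open>a' - a\<close> in \<open>E - E'\<close> and \<open>y - a\<close> in \<open>E\<close>.\<close>
    then have "(a' - a) * E - (y - a) * (E - E') \<in> I"
      by (intro diff_mem mult_mem)
    also have "(a' - a) * E - (y - a) * (E - E') = ?Q y"
      unfolding E_def E'_def \<kappa>_def by (simp add: algebra_simps power2_eq_square)
    finally show ?thesis .
  qed
  have "A \<approx> A'"
    unfolding eqv_def by (rule quadratic_coeffs_mem(3)[OF R(1) quadratic R(2)])
  then have "(a ^ q) ^ q \<approx> (a' ^ q) ^ q"
    unfolding A_def A'_def by (rule eqv_power)
  then have a: "a \<approx> a'"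
    using conjugate_conjugate eqv_sym eqv_trans by meson
  obtain y where "y \<in> R"
    using R(1) by fastforce
  have "(y - a) ^ (q + 1) \<approx> (y - a') ^ (q + 1)"
    by (intro eqv_power eqv_diff a eqv_refl)
  then have "c \<approx> c'"
    using c \<open>y \<in> R\<close> eqv_sym eqv_trans by meson
  with a show ?thesis
    by blast
qed

text \<open>
  Two Moebius maps that agree, up to the factor \<open>s\<close>, at three units satisfy a quadratic identity.
  The combination \<open>c\<^sub>1 - b * c\<^sub>2 - b ^ q * c\<^sub>0\<close> of its coefficients factors as
  \<open>(s - 1) * (1 - b ^ (q + 1))\<close>. Hence \<open>s \<approx> 1\<close>, and \<open>c\<^sub>0 = s * b - b'\<close> gives the claim.
\<close>

lemma moebius_eq_if_agree_at_three:
  assumes R: "card R \<ge> 3" "\<And>x y. x \<in> R \<Longrightarrow> y \<in> R \<Longrightarrow> x \<approx> y \<Longrightarrow> x = y"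
    and agree: "\<And>u. u \<in> R \<Longrightarrow> s * (u + b) * (b' ^ q * u + 1) \<approx> (u + b') * (b ^ q * u + 1)"
    and b: "\<not> b ^ (q + 1) \<approx> 1"
  shows "b \<approx> b'"
proof -
  define c0 c1 c2 where "c0 = s * b - b'" and "c1 = s + s * b * b' ^ q - 1 - b' * b ^ q"
    and "c2 = s * b' ^ q - b ^ q"
  have "c0 + c1 * u + c2 * u ^ 2 \<in> I" if "u \<in> R" for u
  proof -
    have "c0 + c1 * u + c2 * u ^ 2 =
        s * (u + b) * (b' ^ q * u + 1) - (u + b') * (b ^ q * u + 1)"
      unfolding c0_def c1_def c2_def by (simp add: algebra_simps power2_eq_square)
    then show ?thesis
      using agree[OF that] by (simp add: eqv_def)
  qed
  note coeffs = quadratic_coeffs_mem[OF R(1) this R(2)]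
  have "c1 - b * c2 - b ^ q * c0 \<in> I"
    by (intro diff_mem mult_mem coeffs)
  also have "c1 - b * c2 - b ^ q * c0 = (b ^ (q + 1) - 1) * (1 - s)"
    unfolding c0_def c1_def c2_def by (simp add: algebra_simps)
  finally have "1 - s \<in> I"
    using prime b by (auto simp: eqv_def)
  then have "b * (1 - s) + c0 \<in> I"
    by (intro add_mem mult_mem coeffs)
  then show ?thesis
    by (simp add: c0_def eqv_def algebra_simps)
qed

end

section \<open>A family of words in the field with q squared elements\<close>

context quadratic_field
begin

definition residue_class :: "'a \<Rightarrow> 'a set" where
  "residue_class x = {y. x \<approx> y}"

lemma residue_class_eq_iff: "residue_class x = residue_class y \<longleftrightarrow> x \<approx> y"
  unfolding residue_class_def using eqv_sym eqv_trans by blast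

definition representatives :: "'a set" where
  "representatives = insert 0 ((\<lambda>i. g ^ i) ` {..<(q - 1) * (q + 1)})"

lemma gen_power_inject: "i < (q - 1) * (q + 1) \<Longrightarrow> j < (q - 1) * (q + 1) \<Longrightarrow> g ^ i \<approx> g ^ j \<Longrightarrow> i = j"
  by (simp only: gen_power_eqv_iff mod_less)

lemma card_representatives: "card representatives = q ^ 2"
proof -
  have "inj_on (\<lambda>i. g ^ i) {..<(q - 1) * (q + 1)}"
    using gen_power_inject by (intro inj_onI) (metis eqv_refl lessThan_iff)
  then have "card ((\<lambda>i. g ^ i) ` {..<(q - 1) * (q + 1)}) = (q - 1) * (q + 1)"
    by (simp only: card_image card_lessThan)
  moreover have zero: "0 \<notin> (\<lambda>i. g ^ i) ` {..<(q - 1) * (q + 1)}"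
    using gen_power_not_mem zero_mem by (metis imageE)
  ultimately have "card representatives = Suc ((q - 1) * (q + 1))"
    unfolding representatives_def card_insert_disjoint[OF finite_imageI[OF finite_lessThan] zero]
    by (simp only:)
  also have "\<dots> = q ^ 2"
    using q_ge_2 by (cases q) (auto simp: power2_eq_square)
  finally show ?thesis .
qed

lemma representatives_inject:
  assumes "x \<in> representatives" "y \<in> representatives" "x \<approx> y"
  shows "x = y"
proof -
  have zero: "\<not> 0 \<approx> g ^ i" "\<not> g ^ i \<approx> 0" for i
    using gen_power_not_mem eqv_zero_iff eqv_sym by blast+
  show ?thesis
    using assms zero gen_power_inject unfolding representatives_def by blast
qed

lemma residue_class_representative: "residue_class x \<in> residue_class ` representatives"
proof (cases "x \<in> I")
  case True
  then have "residue_class x = residue_class 0"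
    by (simp add: residue_class_eq_iff eqv_zero_iff)
  then show ?thesis
    by (simp add: representatives_def)
next
  case False
  then obtain i where i: "x \<approx> g ^ i"
    using generates by blast
  let ?m = "(q - 1) * (q + 1)"
  have "g ^ i \<approx> g ^ (i mod ?m)"
    by (simp only: gen_power_eqv_iff mod_mod_trivial)
  then have "residue_class x = residue_class (g ^ (i mod ?m))"
    using i eqv_trans residue_class_eq_iff by blast
  moreover have "i mod ?m < ?m"
    using pred_q_pos by (intro mod_less_divisor) simp
  ultimately show ?thesis
    unfolding representatives_def by blast
qed

lemma card_residue_classes: "card (residue_class ` representatives) = q ^ 2"
  using representatives_inject card_representatives
  by (subst card_image) (auto intro!: inj_onI simp: residue_class_eq_iff)

text \<open>
  The exponent with respect to \<open>unit\<close> of the value at \<open>unit j\<close> of the Moebius map with parameter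
  \<open>b\<close>, for \<open>b\<close> of norm different from one.
\<close>

definition moebius :: "'a \<Rightarrow> nat \<Rightarrow> nat" where
  "moebius b j = (SOME e. e \<le> q \<and> unit e * (b ^ q * unit j + 1) \<approx> unit j + b)"

lemma moebius:
  assumes "\<not> b ^ (q + 1) \<approx> 1"
  shows "moebius b j \<le> q" "unit (moebius b j) * (b ^ q * unit j + 1) \<approx> unit j + b"
  using someI_ex[OF moebius_maps_units_to_units[OF assms, of j]] unfolding moebius_def by blast+

definition word :: "'a \<Rightarrow> nat \<Rightarrow> 'a \<Rightarrow> ('a set \<times> nat) set" where
  "word a k b = (\<lambda>j. (residue_class (a + g ^ k * unit j), moebius b j)) ` {..q}"

lemma circle_inject:
  assumes "a + g ^ k * unit i \<approx> a + g ^ k * unit j"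
  shows "unit i \<approx> unit j"
proof -
  have "g ^ k * unit i \<approx> g ^ k * unit j"
    using eqv_diff[OF assms eqv_refl[of a]] by simp
  then show ?thesis
    using eqv_cancel gen_power_not_mem by blast
qed

lemma inj_on_circle: "inj_on (\<lambda>j. residue_class (a + g ^ k * unit j)) {..q}"
  using unit_inject circle_inject by (intro inj_onI) (metis residue_class_eq_iff atMost_iff)

lemma word_properties:
  assumes "\<not> b ^ (q + 1) \<approx> 1"
  shows "word a k b \<subseteq> residue_class ` representatives \<times> {..q}"
    and "card (word a k b) = q + 1"
    and "inj_on fst (word a k b)"
proof -
  show "word a k b \<subseteq> residue_class ` representatives \<times> {..q}"
    using residue_class_representative moebius(1)[OF assms] unfolding word_def by blast
  have "inj_on (fst \<circ> (\<lambda>j. (residue_class (a + g ^ k * unit j), moebius b j))) {..q}"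
    using inj_on_circle by (simp add: comp_def)
  then show "inj_on fst (word a k b)"
    unfolding word_def by (rule inj_on_imageI)
  have "inj_on (\<lambda>j. (residue_class (a + g ^ k * unit j), moebius b j)) {..q}"
    using inj_on_circle[of a k] by (auto simp: inj_on_def)
  then show "card (word a k b) = q + 1"
    unfolding word_def by (simp add: card_image)
qed

text \<open>
  The common points lie on both circles, so that the circles coincide. The points are then compared
  by their positions on the circle, where a cyclic shift by \<open>t\<close> amounts to multiplying the Moebius
  map by \<open>unit t\<close>.
\<close>

lemma words_eq_if_three_common_points:
  assumes b: "\<not> b ^ (q + 1) \<approx> 1" "\<not> b' ^ (q + 1) \<approx> 1" and k: "k < q - 1" "k' < q - 1"
    and three: "card {p \<in> word a k b. (fst p, (snd p + t) mod (q + 1)) \<in> word a' k' b'} \<ge> 3"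
  shows "a \<approx> a' \<and> k = k' \<and> b \<approx> b'"
proof -
  define J where "J = {j. j \<le> q \<and>
    (residue_class (a + g ^ k * unit j), (moebius b j + t) mod (q + 1)) \<in> word a' k' b'}"
  have fin: "finite J"
    unfolding J_def by simp
  have "{p \<in> word a k b. (fst p, (snd p + t) mod (q + 1)) \<in> word a' k' b'} \<subseteq>
      (\<lambda>j. (residue_class (a + g ^ k * unit j), moebius b j)) ` J" (is "?Z \<subseteq> ?f ` J")
  proof
    fix p assume p: "p \<in> ?Z"
    then obtain j where j: "j \<le> q" "p = ?f j"
      unfolding word_def[of a] by blast
    then have "j \<in> J"
      using p unfolding J_def by simp
    then show "p \<in> ?f ` J"
      using j(2) by blast
  qed
  then have "card ?Z \<le> card J"
    using fin by (meson card_image_le card_mono finite_imageI le_trans)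
  then have card_J: "card J \<ge> 3"
    using three by linarith
  have J: "\<exists>i\<le>q. a + g ^ k * unit j \<approx> a' + g ^ k' * unit i \<and> (moebius b j + t) mod (q + 1) = moebius b' i"
    if "j \<in> J" for j
    using that unfolding J_def word_def by (auto simp: residue_class_eq_iff)
  have J_le: "j \<le> q" if "j \<in> J" for j
    using that unfolding J_def by blast
  let ?R = "(\<lambda>j. a + g ^ k * unit j) ` J"
  have R_inject: "x = y" if "x \<in> ?R" "y \<in> ?R" "x \<approx> y" for x y
    using that J_le circle_inject unit_inject by blast
  have "inj_on (\<lambda>j. a + g ^ k * unit j) J"
    using J_le circle_inject unit_inject by (intro inj_onI) (metis eqv_refl)
  then have card_R: "card ?R \<ge> 3"
    using card_J by (simp add: card_image)
  have "a \<approx> a' \<and> g ^ (k * (q + 1)) \<approx> g ^ (k' * (q + 1))"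
  proof (rule circles_eq_if_three_common_points[OF card_R R_inject])
    fix y assume "y \<in> ?R"
    then obtain j where j: "j \<in> J" "y = a + g ^ k * unit j"
      by blast
    have "y - a = g ^ k * unit j"
      by (simp add: j(2))
    then show "(y - a) ^ (q + 1) \<approx> g ^ (k * (q + 1))"
      by (simp only: norm_polar)
    obtain i where "y \<approx> a' + g ^ k' * unit i"
      using J[OF j(1)] j(2) by blast
    from eqv_diff[OF this eqv_refl[of a']] have "y - a' \<approx> g ^ k' * unit i"
      by simp
    then have "(y - a') ^ (q + 1) \<approx> (g ^ k' * unit i) ^ (q + 1)"
      by (rule eqv_power)
    then show "(y - a') ^ (q + 1) \<approx> g ^ (k' * (q + 1))"
      using norm_polar eqv_trans by blast
  qed
  then have a: "a \<approx> a'" and "k = k'"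
    using gen_norm_inject k by blast+
  have agree: "(moebius b j + t) mod (q + 1) = moebius b' j" if j: "j \<in> J" for j
  proof -
    obtain i where i: "i \<le> q" "a + g ^ k * unit j \<approx> a' + g ^ k' * unit i"
      "(moebius b j + t) mod (q + 1) = moebius b' i"
      using J[OF j] by blast
    have "a' + g ^ k' * unit i \<approx> a + g ^ k * unit i"
      unfolding \<open>k = k'\<close> using eqv_sym[OF a] by (intro eqv_add eqv_refl)
    then have "i = j"
      using i(1,2) J_le[OF j] circle_inject unit_inject eqv_trans by metis
    then show ?thesis
      using i(3) by simp
  qed
  have "b \<approx> b'"
  proof (rule moebius_eq_if_agree_at_three[of "unit ` J" "unit t"])
    have "inj_on unit J"
      using J_le unit_inject by (intro inj_onI) (metis eqv_refl)
    then show "card (unit ` J) \<ge> 3"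
      using card_J by (simp add: card_image)
    show "x = y" if "x \<in> unit ` J" "y \<in> unit ` J" "x \<approx> y" for x y
      using that J_le unit_inject by blast
    fix u assume "u \<in> unit ` J"
    then obtain j where j: "j \<in> J" "u = unit j"
      by blast
    let ?e = "moebius b j" and ?e' = "moebius b' j"
    have "unit ?e' \<approx> unit (?e + t)"
      unfolding unit_eqv_iff agree[OF j(1), symmetric] by simp
    then have e': "unit ?e' \<approx> unit t * unit ?e"
      by (simp add: unit_add mult.commute)
    have "unit t * (u + b) * (b' ^ q * u + 1) \<approx>
        unit t * (unit ?e * (b ^ q * u + 1)) * (b' ^ q * u + 1)"
      unfolding j(2) by (intro eqv_mult eqv_refl eqv_sym[OF moebius(2)[OF b(1)]])
    also have "\<dots> = (unit t * unit ?e) * ((b' ^ q * u + 1) * (b ^ q * u + 1))"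
      by (simp only: mult_ac)
    also have "\<dots> \<approx> unit ?e' * ((b' ^ q * u + 1) * (b ^ q * u + 1))"
      by (intro eqv_mult eqv_refl eqv_sym[OF e'])
    also have "\<dots> = (unit ?e' * (b' ^ q * u + 1)) * (b ^ q * u + 1)"
      by (simp only: mult_ac)
    also have "\<dots> \<approx> (u + b') * (b ^ q * u + 1)"
      unfolding j(2) by (intro eqv_mult eqv_refl moebius(2)[OF b(2)])
    finally show "unit t * (u + b) * (b' ^ q * u + 1) \<approx> (u + b') * (b ^ q * u + 1)" .
  qed (rule b(1))
  with a \<open>k = k'\<close> show ?thesis
    by blast
qed

text \<open>
  In polar coordinates, the nonzero elements whose norm is not one.
\<close>

definition moebius_parameters :: "'a set" where
  "moebius_parameters = (\<lambda>(r, l). g ^ r * unit l) ` ({1..<q - 1} \<times> {..q})"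

lemma moebius_parameter_norm:
  assumes "b \<in> moebius_parameters"
  shows "\<not> b ^ (q + 1) \<approx> 1"
proof
  assume eqv_1: "b ^ (q + 1) \<approx> 1"
  obtain r l where r: "1 \<le> r" "r < q - 1" and b: "b = g ^ r * unit l"
    using assms unfolding moebius_parameters_def by auto
  have "g ^ (r * (q + 1)) \<approx> g ^ (0 * (q + 1))"
    using eqv_trans[OF eqv_sym[OF norm_polar] eqv_1[unfolded b]] by simp
  then have "r = 0"
    using r(2) pred_q_pos by (rule gen_norm_inject)
  with r(1) show False
    by simp
qed

lemma polar_inject_parameters:
  assumes "(r, l) \<in> {1..<q - 1} \<times> {..q}" "(r', l') \<in> {1..<q - 1} \<times> {..q}"
    and "g ^ r * unit l \<approx> g ^ r' * unit l'"
  shows "(r, l) = (r', l')"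
  using assms polar_inject[OF assms(3)] by simp

lemma moebius_parameters_inject:
  "b \<in> moebius_parameters \<Longrightarrow> b' \<in> moebius_parameters \<Longrightarrow> b \<approx> b' \<Longrightarrow> b = b'"
  unfolding moebius_parameters_def using polar_inject_parameters by fastforce

lemma card_moebius_parameters: "card moebius_parameters = (q - 2) * (q + 1)"
proof -
  have "inj_on (\<lambda>(r, l). g ^ r * unit l) ({1..<q - 1} \<times> {..q})"
    using polar_inject_parameters by (intro inj_onI) (metis (no_types, lifting) case_prod_beta' eqv_refl prod.collapse)
  then show ?thesis
    unfolding moebius_parameters_def by (simp add: card_image numeral_2_eq_2)
qed

lemma exists_word_family:
  "\<exists>F. card F = q ^ 2 * (q - 1) * ((q - 2) * (q + 1)) \<and>
    (\<forall>W\<in>F. W \<subseteq> residue_class ` representatives \<times> {..q} \<and> card W = q + 1 \<and> inj_on fst W) \<and>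
    (\<forall>W\<in>F. \<forall>W'\<in>F. W \<noteq> W' \<longrightarrow>
      (\<forall>t. card {p \<in> W. (fst p, (snd p + t) mod (q + 1)) \<in> W'} \<le> 2))"
proof -
  define P where "P = representatives \<times> {..<q - 1} \<times> moebius_parameters"
  define w where "w = (\<lambda>(a, k, b). word a k b)"
  have meet: "card {p \<in> w x. (fst p, (snd p + t) mod (q + 1)) \<in> w y} \<le> 2"
    if xy: "x \<in> P" "y \<in> P" "x \<noteq> y" for x y t
  proof (rule ccontr)
    assume contra: "\<not> ?thesis"
    obtain a k b where x: "x = (a, k, b)"
      by (cases x) auto
    obtain a' k' b' where y: "y = (a', k', b')"
      by (cases y) auto
    have mem: "a \<in> representatives" "k < q - 1" "b \<in> moebius_parameters"
      "a' \<in> representatives" "k' < q - 1" "b' \<in> moebius_parameters"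
      using xy(1,2) by (auto simp: P_def x y)
    have "a \<approx> a' \<and> k = k' \<and> b \<approx> b'"
    proof (rule words_eq_if_three_common_points)
      show "card {p \<in> word a k b. (fst p, (snd p + t) mod (q + 1)) \<in> word a' k' b'} \<ge> 3"
        using contra by (simp add: w_def x y)
    qed (use mem moebius_parameter_norm in auto)
    then have "x = y"
      using mem representatives_inject moebius_parameters_inject unfolding x y by blast
    with xy(3) show False
      by blast
  qed
  have props: "w x \<subseteq> residue_class ` representatives \<times> {..q} \<and> card (w x) = q + 1 \<and> inj_on fst (w x)"
    if "x \<in> P" for x
  proof -
    obtain a k b where x: "x = (a, k, b)"
      by (cases x) auto
    then have "\<not> b ^ (q + 1) \<approx> 1"
      using that moebius_parameter_norm by (simp add: P_def)
    then show ?thesis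
      using word_properties[of b a k] by (simp add: w_def x)
  qed
  have "inj_on w P"
  proof (rule inj_onI, rule ccontr)
    fix x y assume xy: "x \<in> P" "y \<in> P" "w x = w y" "x \<noteq> y"
    \<comment> \<open>Equal words would meet in \<open>q + 1\<close> points without any shift, and \<open>q + 1 \<ge> 3\<close>.\<close>
    have "snd p \<le> q" if "p \<in> w x" for p
      using props[OF xy(1)] that by (metis SigmaE atMost_iff snd_conv subsetD)
    then have "{p \<in> w x. (fst p, (snd p + 0) mod (q + 1)) \<in> w y} = w x"
      using xy(3) by (auto simp: le_imp_less_Suc)
    then have "q + 1 \<le> 2"
      using meet[of x y 0] props[OF xy(1)] xy by metis
    then show False
      using q_ge_2 by simp
  qed
  then have "card (w ` P) = card P"
    by (rule card_image)
  also have "card P = q ^ 2 * (q - 1) * ((q - 2) * (q + 1))"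
    by (simp only: P_def card_cartesian_product card_representatives card_moebius_parameters
        card_lessThan mult.assoc)
  finally show ?thesis
    using meet props by (intro exI[of _ "w ` P"]) blast
qed

end

section \<open>From families of words to codes\<close>

definition array_of :: "nat \<Rightarrow> (nat \<Rightarrow> nat) \<Rightarrow> nat \<Rightarrow> (nat \<Rightarrow> nat) set \<Rightarrow> (nat \<Rightarrow> nat) \<Rightarrow> nat" where
  "array_of n \<Lambda> T X = (\<lambda>i\<in>index_tuples n \<Lambda> T. if i \<in> X then 1 else 0)"

lemma array_of_in_binary_arrays: "array_of n \<Lambda> T X \<in> binary_arrays n \<Lambda> T"
  by (auto simp: array_of_def binary_arrays_def)

lemma support_array_of:
  assumes "X \<subseteq> index_tuples n \<Lambda> T"
  shows "{i \<in> index_tuples n \<Lambda> T. array_of n \<Lambda> T X i = 1} = X"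
  using assms by (auto simp: array_of_def)

lemma shift_last_in_index_tuples:
  assumes "i \<in> index_tuples n \<Lambda> T" "n \<ge> 1" "T > 0"
  shows "shift_last n T t i \<in> index_tuples n \<Lambda> T"
  using assms unfolding index_tuples_def shift_last_def by (auto simp: PiE_iff extensional_def)

lemma correlation_array_of:
  assumes "X \<subseteq> index_tuples n \<Lambda> T" "n \<ge> 1" "T > 0"
  shows "correlation n \<Lambda> T (array_of n \<Lambda> T X) (array_of n \<Lambda> T Y) t = card {i \<in> X. shift_last n T t i \<in> Y}"
proof -
  let ?D = "index_tuples n \<Lambda> T"
  have fin: "finite ?D"
    unfolding index_tuples_def by (intro finite_PiE) auto
  have "correlation n \<Lambda> T (array_of n \<Lambda> T X) (array_of n \<Lambda> T Y) t =
      (\<Sum>i\<in>?D. if i \<in> X \<and> shift_last n T t i \<in> Y then 1 else 0)"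
    unfolding correlation_def array_of_def
    using shift_last_in_index_tuples[OF _ assms(2,3)] by (intro sum.cong) auto
  also have "\<dots> = card {i \<in> ?D. i \<in> X \<and> shift_last n T t i \<in> Y}"
    using fin by (simp add: sum.If_cases Int_def)
  also have "{i \<in> ?D. i \<in> X \<and> shift_last n T t i \<in> Y} = {i \<in> X. shift_last n T t i \<in> Y}"
    using assms(1) by blast
  finally show ?thesis .
qed

text \<open>
  Only the last coordinate is shifted, so the first \<open>n - 1\<close> coordinates may be replaced by a single
  one with values in any set \<open>V\<close> that is not larger than the product of their ranges. A word that
  meets every row in at most one point never meets its own proper shifts.
\<close>

lemma exists_ideal_OOC_of_words:
  fixes F :: "('v \<times> nat) set set"
  assumes n: "n \<ge> 2" and T: "T > 0" and V: "finite V" "card V \<le> (\<Prod>s\<in>{1..n - 1}. \<Lambda> s)"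
    and F: "\<And>W. W \<in> F \<Longrightarrow> W \<subseteq> V \<times> {..<T} \<and> card W = w \<and> inj_on fst W"
    and meet: "\<And>W W' t. W \<in> F \<Longrightarrow> W' \<in> F \<Longrightarrow> W \<noteq> W' \<Longrightarrow>
      card {p \<in> W. (fst p, (snd p + t) mod T) \<in> W'} \<le> lc"
  shows "\<exists>C. is_ideal_OOC n \<Lambda> T w lc C \<and> card C = card F"
proof -
  let ?D = "index_tuples n \<Lambda> T"
  define rows where "rows = (\<Pi>\<^sub>E s\<in>{1..n - 1}. {..<\<Lambda> s})"
  have "finite rows"
    unfolding rows_def by (intro finite_PiE) auto
  moreover have "card rows = (\<Prod>s\<in>{1..n - 1}. \<Lambda> s)"
    unfolding rows_def by (simp add: card_PiE)
  ultimately obtain h where h: "h ` V \<subseteq> rows" "inj_on h V"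
    using card_le_inj[of V rows] V by auto
  define \<phi> where "\<phi> p = (h (fst p))(n := snd p)" for p :: "'v \<times> nat"
  have \<phi>_mem: "\<phi> p \<in> ?D" if "p \<in> V \<times> {..<T}" for p
  proof -
    have "h (fst p) \<in> rows"
      using that h(1) by auto
    then show ?thesis
      using that n unfolding index_tuples_def rows_def \<phi>_def by (auto simp: PiE_iff extensional_def)
  qed
  have \<phi>_inject: "p = p'" if "p \<in> V \<times> {..<T}" "p' \<in> V \<times> {..<T}" "\<phi> p = \<phi> p'" for p p'
  proof -
    have "h (fst p) s = h (fst p') s" for s
    proof (cases "s = n")
      case True
      have "h (fst p) \<in> rows" "h (fst p') \<in> rows"
        using that h(1) by auto
      moreover have "n \<notin> {1..n - 1}"
        using n by auto
      ultimately show ?thesis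
        unfolding True rows_def by (metis PiE_arb)
    next
      case False
      then show ?thesis
        using fun_cong[OF that(3), of s] by (simp add: \<phi>_def)
    qed
    then have "h (fst p) = h (fst p')"
      by (rule ext)
    then have "fst p = fst p'"
      using that(1,2) h(2) by (auto dest: inj_onD)
    moreover have "snd p = snd p'"
      using fun_cong[OF that(3), of n] by (simp add: \<phi>_def)
    ultimately show ?thesis
      by (rule prod_eqI)
  qed
  have shift: "shift_last n T t (\<phi> p) = \<phi> (fst p, (snd p + t) mod T)" for p t
    by (simp add: shift_last_def \<phi>_def)
  have \<phi>_image: "\<phi> ` W \<subseteq> ?D" if "W \<in> F" for W
    using F[OF that] \<phi>_mem by blast
  have \<phi>_image_mem: "\<phi> p \<in> \<phi> ` W \<longleftrightarrow> p \<in> W" if "W \<in> F" "p \<in> V \<times> {..<T}" for W p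
    using F[OF that(1)] that(2) \<phi>_inject by blast
  have inj_\<phi>: "inj_on \<phi> W" if "W \<in> F" for W
    using F[OF that] \<phi>_inject by (intro inj_onI) blast
  define c where "c W = array_of n \<Lambda> T (\<phi> ` W)" for W
  have correlation: "correlation n \<Lambda> T (c W) (c W') t = card {p \<in> W. (fst p, (snd p + t) mod T) \<in> W'}"
    if "W \<in> F" "W' \<in> F" for W W' t
  proof -
    have "(fst p, (snd p + t) mod T) \<in> V \<times> {..<T}" if "p \<in> W" for p
      using F[OF \<open>W \<in> F\<close>] that T by auto
    then have "shift_last n T t (\<phi> p) \<in> \<phi> ` W' \<longleftrightarrow> (fst p, (snd p + t) mod T) \<in> W'" if "p \<in> W" for p
      unfolding shift using \<phi>_image_mem[OF \<open>W' \<in> F\<close>] that by blast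
    then have "{i \<in> \<phi> ` W. shift_last n T t i \<in> \<phi> ` W'} =
        \<phi> ` {p \<in> W. (fst p, (snd p + t) mod T) \<in> W'}"
      by blast
    moreover have "correlation n \<Lambda> T (c W) (c W') t = card {i \<in> \<phi> ` W. shift_last n T t i \<in> \<phi> ` W'}"
      unfolding c_def using n by (intro correlation_array_of \<phi>_image that(1) T) simp
    ultimately show ?thesis
      using inj_on_subset[OF inj_\<phi>[OF that(1)]] by (simp add: card_image)
  qed
  have support: "{i \<in> ?D. c W i = 1} = \<phi> ` W" if "W \<in> F" for W
    unfolding c_def by (rule support_array_of[OF \<phi>_image[OF that]])
  have "inj_on c F"
  proof (rule inj_onI)
    fix W W' assume W: "W \<in> F" "W' \<in> F" "c W = c W'"
    have "\<phi> ` W = \<phi> ` W'"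
      using support[OF W(1)] support[OF W(2)] W(3) by simp
    then show "W = W'"
      using \<phi>_image_mem F W(1,2) by blast
  qed
  then have "card (c ` F) = card F"
    by (rule card_image)
  moreover have "is_ideal_OOC n \<Lambda> T w lc (c ` F)"
    unfolding is_ideal_OOC_def is_OOC_def
  proof (intro conjI ballI allI impI)
    show "c ` F \<subseteq> binary_arrays n \<Lambda> T"
      unfolding c_def using array_of_in_binary_arrays by blast
    fix A assume "A \<in> c ` F"
    then obtain W where W: "W \<in> F" "A = c W"
      by blast
    show "card {i \<in> ?D. A i = 1} = w"
      using W support F card_image[OF inj_\<phi>] by simp
    show "correlation n \<Lambda> T A A t \<le> 0" if t: "1 \<le> t \<and> t < T" for t
    proof -
      have False if p: "p \<in> W" "(fst p, (snd p + t) mod T) \<in> W" for p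
      proof -
        have "p = (fst p, (snd p + t) mod T)"
          using F[OF W(1)] p by (metis inj_onD fst_conv)
        then have eq: "snd p = (snd p + t) mod T"
          by (metis snd_conv)
        have "snd p < T"
          using F[OF W(1)] p(1) by auto
        then show False
          using eq t by (auto simp: mod_if split: if_splits)
      qed
      then have "{p \<in> W. (fst p, (snd p + t) mod T) \<in> W} = {}"
        by blast
      then show ?thesis
        unfolding W(2) correlation[OF W(1) W(1)] by (simp only: card.empty)
    qed
    fix B t assume "B \<in> c ` F" "A \<noteq> B"
    then obtain W' where "W' \<in> F" "B = c W'" "W \<noteq> W'"
      using W(2) by blast
    then show "correlation n \<Lambda> T A B t \<le> lc"
      using correlation meet W by simp
  qed
  ultimately show ?thesis
    by blast
qed

section \<open>The Johnson bound and the limit\<close>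

text \<open>
  All three quotients are integers, so that rounding down has no effect.
\<close>

lemma ideal_johnson_bound_quadric:
  assumes q: "q \<ge> 2" and prod: "(\<Prod>s\<in>{1..n - 1}. \<Lambda> s) = q ^ 2 + 1"
  shows "ideal_johnson_bound n \<Lambda> (q + 1) (q + 1) 2 = int (q * (q + 1) ^ 2 * (q ^ 2 + 1))"
proof -
  define N where "N = real ((\<Prod>s\<in>{1..n - 1}. \<Lambda> s) * (q + 1))"
  define x where "x = real q"
  have x: "x \<ge> 2" and T: "real (q + 1) = x + 1"
    using q by (simp_all add: x_def)
  have N: "N = (x ^ 2 + 1) * (x + 1)"
    unfolding N_def prod x_def by (simp add: distrib_left distrib_right)
  have "(N - 2 * (x + 1)) / (x + 1 - 2) = (x + 1) ^ 2"
    using x by (simp add: N field_simps) (simp add: algebra_simps power2_eq_square)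
  also have "\<dots> = real_of_int (int ((q + 1) ^ 2))"
    by (simp add: x_def)
  finally have 1: "\<lfloor>(N - 2 * (x + 1)) / (x + 1 - 2)\<rfloor> = int ((q + 1) ^ 2)"
    by (metis floor_of_int)
  have "(N - (x + 1)) / (x + 1 - 1) * real_of_int (int ((q + 1) ^ 2)) = x * (x + 1) ^ 3"
    using x by (simp add: N x_def[symmetric] field_simps) (simp add: algebra_simps power2_eq_square power3_eq_cube)
  also have "\<dots> = real_of_int (int (q * (q + 1) ^ 3))"
    by (simp add: x_def add.commute)
  finally have 2: "\<lfloor>(N - (x + 1)) / (x + 1 - 1) * real_of_int (int ((q + 1) ^ 2))\<rfloor> = int (q * (q + 1) ^ 3)"
    by (metis floor_of_int)
  have "m * y / (y * y) * (x * y ^ 3) = x * y ^ 2 * m" if "y \<noteq> 0" for m y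
    using that by (simp add: power2_eq_square power3_eq_cube)
  moreover have "real_of_int (int (q * (q + 1) ^ 3)) = x * (x + 1) ^ 3"
    by (simp add: x_def add.commute)
  ultimately have "N / ((x + 1) * (x + 1)) * real_of_int (int (q * (q + 1) ^ 3)) = x * (x + 1) ^ 2 * (x ^ 2 + 1)"
    unfolding N using x by simp
  also have "\<dots> = real_of_int (int (q * (q + 1) ^ 2 * (q ^ 2 + 1)))"
    by (simp add: x_def add.commute distrib_left)
  finally have 3: "\<lfloor>N / ((x + 1) * (x + 1)) * real_of_int (int (q * (q + 1) ^ 3))\<rfloor> =
      int (q * (q + 1) ^ 2 * (q ^ 2 + 1))"
    by (metis floor_of_int)
  show ?thesis
    unfolding ideal_johnson_bound_2[OF N_def] T 1 2 3 ..
qed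

lemma code_size_ratio_tendsto:
  "((\<lambda>q::nat. (real q ^ 2 * (real q - 1) * ((real q - 2) * (real q + 1))) /
      (real q * (real q + 1) ^ 2 * (real q ^ 2 + 1))) \<longlongrightarrow> 1) sequentially"
  by real_asymp

text \<open>
  The \<open>q\<^sup>2\<close> residue classes are mapped injectively to the \<open>q\<^sup>2 + 1\<close> rows. The row that is left over
  plays the part of the point at infinity of the inversive plane of order \<open>q\<close>.
\<close>

theorem exists_large_ideal_OOC:
  assumes n: "n \<ge> 2" and q: "primepow q" and prod: "(\<Prod>s\<in>{1..n - 1}. \<Lambda> s) = q ^ 2 + 1"
  shows "\<exists>C. is_ideal_OOC n \<Lambda> (q + 1) (q + 1) 2 C \<and>
    card C = q ^ 2 * (q - 1) * ((q - 2) * (q + 1))"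
proof -
  obtain I :: "int poly set" and g where "quadratic_field I q g"
    using exists_quadratic_field[OF q] by blast
  then interpret quadratic_field I q g .
  let ?V = "residue_class ` representatives"
  obtain F where card_F: "card F = q ^ 2 * (q - 1) * ((q - 2) * (q + 1))"
    and F: "\<forall>W\<in>F. W \<subseteq> ?V \<times> {..q} \<and> card W = q + 1 \<and> inj_on fst W"
    and meet: "\<forall>W\<in>F. \<forall>W'\<in>F. W \<noteq> W' \<longrightarrow>
      (\<forall>t. card {p \<in> W. (fst p, (snd p + t) mod (q + 1)) \<in> W'} \<le> 2)"
    using exists_word_family by (elim exE conjE)
  have "{..q} = {..<q + 1}"
    by auto
  then have F': "W \<subseteq> ?V \<times> {..<q + 1} \<and> card W = q + 1 \<and> inj_on fst W" if "W \<in> F" for W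
    using F that by simp
  have fin: "finite ?V"
    unfolding representatives_def by simp
  have card_V: "card ?V \<le> (\<Prod>s\<in>{1..n - 1}. \<Lambda> s)"
    unfolding card_residue_classes prod by simp
  have "\<exists>C. is_ideal_OOC n \<Lambda> (q + 1) (q + 1) 2 C \<and> card C = card F"
  proof (rule exists_ideal_OOC_of_words[OF n _ fin card_V F'])
    show "card {p \<in> W. (fst p, (snd p + t) mod (q + 1)) \<in> W'} \<le> 2"
      if "W \<in> F" "W' \<in> F" "W \<noteq> W'" for W W' t
      using meet that by blast
  qed simp
  then show ?thesis
    by (simp only: card_F)
qed

theorem corollary3p6:
  fixes n :: nat and \<Lambda> :: "nat \<Rightarrow> nat \<Rightarrow> nat"
  assumes "n \<ge> 2"
    and "\<And>q s. primepow q \<Longrightarrow> s \<in> {1..n - 1} \<Longrightarrow> \<Lambda> q s > 0"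
    and "\<And>q. primepow q \<Longrightarrow> (\<Prod>s\<in>{1..n - 1}. \<Lambda> q s) = q ^ 2 + 1"
  shows "\<exists>C :: nat \<Rightarrow> ((nat \<Rightarrow> nat) \<Rightarrow> nat) set.
    (\<forall>q. primepow q \<longrightarrow> is_ideal_OOC n (\<Lambda> q) (q + 1) (q + 1) 2 (C q)) \<and>
    ((\<lambda>q. real (card (C q)) / real_of_int (ideal_johnson_bound n (\<Lambda> q) (q + 1) (q + 1) 2))
      \<longlongrightarrow> 1) (inf sequentially (principal {q. primepow q}))"
proof -
  have "\<forall>q. \<exists>C. primepow q \<longrightarrow> is_ideal_OOC n (\<Lambda> q) (q + 1) (q + 1) 2 C \<and>
      card C = q ^ 2 * (q - 1) * ((q - 2) * (q + 1))"
    using exists_large_ideal_OOC[OF assms(1) _ assms(3)] by blast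
  then obtain C where C: "\<And>q. primepow q \<Longrightarrow> is_ideal_OOC n (\<Lambda> q) (q + 1) (q + 1) 2 (C q)"
    and card_C: "\<And>q. primepow q \<Longrightarrow> card (C q) = q ^ 2 * (q - 1) * ((q - 2) * (q + 1))"
    by metis
  let ?F = "inf sequentially (principal {q :: nat. primepow q})"
  let ?r = "\<lambda>q::nat. real q ^ 2 * (real q - 1) * ((real q - 2) * (real q + 1)) /
      (real q * (real q + 1) ^ 2 * (real q ^ 2 + 1))"
  have ratio: "real (card (C q)) / real_of_int (ideal_johnson_bound n (\<Lambda> q) (q + 1) (q + 1) 2) = ?r q"
    if q: "primepow q" for q
  proof -
    have "q \<ge> 2"
      using primepow_gt_Suc_0[OF q] by simp
    then have "ideal_johnson_bound n (\<Lambda> q) (q + 1) (q + 1) 2 = int (q * (q + 1) ^ 2 * (q ^ 2 + 1))"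
      by (intro ideal_johnson_bound_quadric assms(3) q)
    moreover have "real (q - 1) = real q - 1" "real (q - 2) = real q - 2"
      using \<open>q \<ge> 2\<close> by (simp_all add: of_nat_diff)
    ultimately show ?thesis
      by (simp only: card_C[OF q] of_int_of_nat_eq of_nat_mult of_nat_power of_nat_add of_nat_1
        of_int_mult of_int_power of_int_add of_int_1)
  qed
  have "(?r \<longlongrightarrow> 1) ?F"
    using code_size_ratio_tendsto by (rule tendsto_mono[OF inf_le1])
  then have "((\<lambda>q. real (card (C q)) / real_of_int (ideal_johnson_bound n (\<Lambda> q) (q + 1) (q + 1) 2))
      \<longlongrightarrow> 1) ?F"
  proof (rule Lim_transform_eventually)
    show "eventually (\<lambda>q. ?r q =
        real (card (C q)) / real_of_int (ideal_johnson_bound n (\<Lambda> q) (q + 1) (q + 1) 2)) ?F"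
      unfolding eventually_inf_principal using ratio by (intro always_eventually) simp
  qed
  with C show ?thesis
    by blast
qed

end
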